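(* (Wall-crossing formula for triangulated categories.) Let $\mathcal{D}$ be a Krull-Schmidt, left homologically finite triangulated category over a finite field $k$, and let $\sigma=(Z,\mathcal{P})$ be a stability condition on $\mathcal{D}$. Then $$1_{\mathcal{D}}=\prod^{\leftarrow}_{\phi\in\mathbb{R}}\mathrm{SS}^\sigma_\phi,$$ where $1_{\mathcal{D}}$ is the function taking the value $1$ on every isomorphism class of objects of $\mathcal{D}$ and $\mathrm{SS}^\sigma_\phi$ is the characteristic function of $\mathcal{P}(\phi)$ (including the zero object).
   Context: Left homologically finite: $\sum_{i\geqslant 0}\dim_k\mathrm{Hom}_{\mathcal{D}}(X[i],Y)<+\infty$ for all $X,Y\in\mathcal{D}$. Derived Hall algebra: $\mathcal{H}(\mathcal{D})$ is the $\mathbb{Q}$-vector space with basis $u_{[M]}$ indexed by isomorphism classes of objects of $\mathcal{D}$, with associative product $u_{[M]}*u_{[N]}=\sum_{[L]}F^L_{MN}u_{[L]}$ and unit $1=u_{[0]}$, where $$F_{MN}^L=\frac{|(L,N)_{M[1]}|}{|\mathrm{Aut}\,N|}\cdot\frac{\{L,N\}}{\{N,N\}},\quad (L,N)_{M[1]}=\{f\in\mathrm{Hom}_{\mathcal{D}}(L,N)\mid \mathrm{cone} f\cong M[1]\},\quad \{L,N\}=\prod_{i>0}|\mathrm{Hom}_{\mathcal{D}}(L[i],N)|^{(-1)^i}.$$ Elements are viewed as functions on isomorphism classes ($f(M)$ is the coefficient of $u_{[M]}$); identities between possibly infinite sums and products are identities of such functions, with $*$ extended bilinearly and evaluated at each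 isomorphism class. Stability condition: a pair $\sigma=(Z,\mathcal{P})$ with $Z:K_0(\mathcal{D})\to\mathbb{C}$ a group homomorphism and $\mathcal{P}(\phi)$ ($\phi\in\mathbb{R}$) full additive extension-closed subcategories of $\mathcal{D}$ such that (1) a nonzero $M\in\mathcal{P}(\phi)$ has $Z(M)=m_Me^{i\pi\phi}$ with $m_M>0$; (2) $\mathcal{P}(\phi+1)=\mathcal{P}(\phi)[1]$; (3) $\mathrm{Hom}_{\mathcal{D}}(A_1,A_2)=0$ for $A_i\in\mathcal{P}(\phi_i)$, $\phi_1>\phi_2$; (4) every $0\neq M$ has a Harder-Narasimhan (HN) filtration: triangles $M_{i-1}\to M_i\to A_i\to M_{i-1}[1]$, $1\leqslant i\leqslant n$, $M_0=0$, $M_n=M$, with $0\neq A_i\in\mathcal{P}(\phi_i)$ and $\phi_1>\dots>\phi_n$ (unique up to isomorphism). Equivalently, $\mathrm{SS}^\sigma_\phi=1+\sum_{\gamma}{}^{m}\delta^\sigma_\gamma$ for $\phi\in(2m-1,2m+1]$, the sum being over $\gamma\in K_0(\mathcal{D})$ with $Z(\gamma)\in\mathbb{R}_{>0}e^{i\pi\phi}$, where ${}^{m}\delta^\sigma_\gamma$ is the characteristic function of the set of $\sigma$-semistable objects (nonzero objects of some $\mathcal{P}(\psi)$) of class $\gamma$ and phase $\psi\in(2m-1,2m+1]$. The product $\prod^{\leftarrow}_{\phi\in\mathbb{R}}$ is the product in order of descending phase, meaning $$\prod^{\leftarrow}_{\phi\in\mathbb{R}}\mathrm{SS}^\sigma_\phi=1+\sum_{s\geqslant1}\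 \sum_{\phi_1>\phi_2>\dots>\phi_s}(\mathrm{SS}^\sigma_{\phi_1}-1)*(\mathrm{SS}^\sigma_{\phi_2}-1)*\dots*(\mathrm{SS}^\sigma_{\phi_s}-1).$$ *)

theory Defs
  imports
    Complex_Main
    "HOL-Algebra.Free_Abelian_Groups"
    "Jordan_Normal_Form.Missing_VectorSpace"
begin

section \<open>Linear categories\<close>

text \<open>
  Hom-sets are \<^typ>\<open>('k, 'm) module\<close> records, of which only the carrier, the addition, the zero and
  the scalar multiplication are used. They need not be pairwise disjoint: the source and the
  target of a morphism are always given along with it.
\<close>

record ('k, 'o, 'm) lincat =
  Obj :: "'o set"
  Hom :: "'o \<Rightarrow> 'o \<Rightarrow> ('k, 'm) module"
  cmp :: "'m \<Rightarrow> 'm \<Rightarrow> 'm"  (infixr \<open>\<bullet>\<index>\<close> 75)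
  idm :: "'o \<Rightarrow> 'm"

abbreviation mor :: "('k, 'o, 'm, 'z) lincat_scheme \<Rightarrow> 'o \<Rightarrow> 'o \<Rightarrow> 'm set"
  where "mor D X Y \<equiv> carrier (Hom D X Y)"

abbreviation zero_mor :: "('k, 'o, 'm, 'z) lincat_scheme \<Rightarrow> 'o \<Rightarrow> 'o \<Rightarrow> 'm"
  where "zero_mor D X Y \<equiv> \<zero>\<^bsub>Hom D X Y\<^esub>"

definition isomorphism :: "('k, 'o, 'm, 'z) lincat_scheme \<Rightarrow> 'o \<Rightarrow> 'o \<Rightarrow> 'm \<Rightarrow> bool"
  where "isomorphism D X Y f \<longleftrightarrow>
    f \<in> mor D X Y \<and> (\<exists>g \<in> mor D Y X. g \<bullet>\<^bsub>D\<^esub> f = idm D X \<and> f \<bullet>\<^bsub>D\<^esub> g = idm D Y)"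

definition iso_obj :: "('k, 'o, 'm, 'z) lincat_scheme \<Rightarrow> 'o \<Rightarrow> 'o \<Rightarrow> bool"
  where "iso_obj D X Y \<longleftrightarrow> X \<in> Obj D \<and> Y \<in> Obj D \<and> (\<exists>f. isomorphism D X Y f)"

definition zero_object :: "('k, 'o, 'm, 'z) lincat_scheme \<Rightarrow> 'o \<Rightarrow> bool"
  where "zero_object D X \<longleftrightarrow>
    X \<in> Obj D \<and> (\<forall>Y \<in> Obj D. (\<exists>!f. f \<in> mor D X Y) \<and> (\<exists>!f. f \<in> mor D Y X))"

text \<open>\<open>direct_sum D X Xs\<close>: for suitable injections and projections, \<open>X\<close> is a biproduct of the
  objects listed in \<open>Xs\<close>.\<close>

definition direct_sum :: "('k, 'o, 'm, 'z) lincat_scheme \<Rightarrow> 'o \<Rightarrow> 'o list \<Rightarrow> bool"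
  where "direct_sum D X Xs \<longleftrightarrow>
    X \<in> Obj D \<and> set Xs \<subseteq> Obj D \<and>
    (\<exists>\<iota> \<pi>.
      (\<forall>i < length Xs. \<iota> i \<in> mor D (Xs ! i) X \<and> \<pi> i \<in> mor D X (Xs ! i)) \<and>
      (\<forall>i < length Xs. \<forall>j < length Xs.
         \<pi> i \<bullet>\<^bsub>D\<^esub> \<iota> j = (if i = j then idm D (Xs ! i) else zero_mor D (Xs ! j) (Xs ! i))) \<and>
      finsum (Hom D X X) (\<lambda>i. \<iota> i \<bullet>\<^bsub>D\<^esub> \<pi> i) {..<length Xs} = idm D X)"

locale linear_category = field K
  for K :: "('k, 'r) ring_scheme" and D :: "('k, 'o, 'm, 'z) lincat_scheme" (structure) +
  assumes hom_vectorspace: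
      "\<lbrakk>X \<in> Obj D; Y \<in> Obj D\<rbrakk> \<Longrightarrow> vectorspace K (Hom D X Y)"
    and id_mor: "X \<in> Obj D \<Longrightarrow> idm D X \<in> mor D X X"
    and cmp_mor:
      "\<lbrakk>X \<in> Obj D; Y \<in> Obj D; Z \<in> Obj D; f \<in> mor D X Y; g \<in> mor D Y Z\<rbrakk> \<Longrightarrow> g \<bullet> f \<in> mor D X Z"
    and id_left: "\<lbrakk>X \<in> Obj D; Y \<in> Obj D; f \<in> mor D X Y\<rbrakk> \<Longrightarrow> idm D Y \<bullet> f = f"
    and id_right: "\<lbrakk>X \<in> Obj D; Y \<in> Obj D; f \<in> mor D X Y\<rbrakk> \<Longrightarrow> f \<bullet> idm D X = f"
    and cmp_assoc:
      "\<lbrakk>W \<in> Obj D; X \<in> Obj D; Y \<in> Obj D; Z \<in> Obj D;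
        f \<in> mor D W X; g \<in> mor D X Y; h \<in> mor D Y Z\<rbrakk> \<Longrightarrow> (h \<bullet> g) \<bullet> f = h \<bullet> (g \<bullet> f)"
    and cmp_add_left:
      "\<lbrakk>X \<in> Obj D; Y \<in> Obj D; Z \<in> Obj D; f \<in> mor D X Y; g \<in> mor D Y Z; g' \<in> mor D Y Z\<rbrakk>
        \<Longrightarrow> (g \<oplus>\<^bsub>Hom D Y Z\<^esub> g') \<bullet> f = (g \<bullet> f) \<oplus>\<^bsub>Hom D X Z\<^esub> (g' \<bullet> f)"
    and cmp_add_right:
      "\<lbrakk>X \<in> Obj D; Y \<in> Obj D; Z \<in> Obj D; f \<in> mor D X Y; f' \<in> mor D X Y; g \<in> mor D Y Z\<rbrakk>
        \<Longrightarrow> g \<bullet> (f \<oplus>\<^bsub>Hom D X Y\<^esub> f') = (g \<bullet> f) \<oplus>\<^bsub>Hom D X Z\<^esub> (g \<bullet> f')"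
    and cmp_smult_left:
      "\<lbrakk>X \<in> Obj D; Y \<in> Obj D; Z \<in> Obj D; f \<in> mor D X Y; g \<in> mor D Y Z; a \<in> carrier K\<rbrakk>
        \<Longrightarrow> (a \<odot>\<^bsub>Hom D Y Z\<^esub> g) \<bullet> f = a \<odot>\<^bsub>Hom D X Z\<^esub> (g \<bullet> f)"
    and cmp_smult_right:
      "\<lbrakk>X \<in> Obj D; Y \<in> Obj D; Z \<in> Obj D; f \<in> mor D X Y; g \<in> mor D Y Z; a \<in> carrier K\<rbrakk>
        \<Longrightarrow> g \<bullet> (a \<odot>\<^bsub>Hom D X Y\<^esub> f) = a \<odot>\<^bsub>Hom D X Z\<^esub> (g \<bullet> f)"

locale additive_linear_category = linear_category +
  assumes zero_object_exists: "\<exists>X. zero_object D X"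
    and direct_sum_exists: "\<lbrakk>X \<in> Obj D; Y \<in> Obj D\<rbrakk> \<Longrightarrow> \<exists>S. direct_sum D S [X, Y]"

definition End_ring :: "('k, 'o, 'm, 'z) lincat_scheme \<Rightarrow> 'o \<Rightarrow> 'm ring"
  where "End_ring D X =
    \<lparr>carrier = mor D X X, monoid.mult = cmp D, one = idm D X,
     zero = zero_mor D X X, add = add (Hom D X X)\<rparr>"

text \<open>Local in the noncommutative sense: nonzero, and the nonunits are closed under addition.\<close>

definition local_ring :: "('a, 'b) ring_scheme \<Rightarrow> bool"
  where "local_ring R \<longleftrightarrow>
    ring R \<and> \<one>\<^bsub>R\<^esub> \<noteq> \<zero>\<^bsub>R\<^esub> \<and>
    (\<forall>a \<in> carrier R. \<forall>b \<in> carrier R.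
       a \<notin> Units R \<longrightarrow> b \<notin> Units R \<longrightarrow> a \<oplus>\<^bsub>R\<^esub> b \<notin> Units R)"

definition krull_schmidt :: "('k, 'o, 'm, 'z) lincat_scheme \<Rightarrow> bool"
  where "krull_schmidt D \<longleftrightarrow>
    (\<forall>X \<in> Obj D. \<exists>Xs. direct_sum D X Xs \<and> (\<forall>Y \<in> set Xs. local_ring (End_ring D Y)))"


section \<open>Triangulated categories\<close>

text \<open>\<open>shO\<close> and \<open>shM\<close> are the shift \<open>[1]\<close> on objects and on morphisms; \<open>dtri D X Y Z f g h\<close> says that
  \<open>X \<rightarrow> Y \<rightarrow> Z \<rightarrow> X[1]\<close> with maps \<open>f\<close>, \<open>g\<close>, \<open>h\<close> is a distinguished triangle.\<close>

record ('k, 'o, 'm) tricat = "('k, 'o, 'm) lincat" +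
  shO :: "'o \<Rightarrow> 'o"
  shM :: "'m \<Rightarrow> 'm"
  dtri :: "'o \<Rightarrow> 'o \<Rightarrow> 'o \<Rightarrow> 'm \<Rightarrow> 'm \<Rightarrow> 'm \<Rightarrow> bool"

text \<open>The shift is only required to be an autoequivalence, which includes automorphisms.\<close>

locale triangulated_category =
  additive_linear_category K D
  for K :: "('k, 'r) ring_scheme" and D :: "('k, 'o, 'm, 'z) tricat_scheme" (structure) +
  assumes sh_obj: "X \<in> Obj D \<Longrightarrow> shO D X \<in> Obj D"
    and sh_fully_faithful:
      "\<lbrakk>X \<in> Obj D; Y \<in> Obj D\<rbrakk> \<Longrightarrow> bij_betw (shM D) (mor D X Y) (mor D (shO D X) (shO D Y))"
    and sh_ess_surj: "Y \<in> Obj D \<Longrightarrow> \<exists>X \<in> Obj D. iso_obj D (shO D X) Y"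
    and sh_id: "X \<in> Obj D \<Longrightarrow> shM D (idm D X) = idm D (shO D X)"
    and sh_cmp:
      "\<lbrakk>X \<in> Obj D; Y \<in> Obj D; Z \<in> Obj D; f \<in> mor D X Y; g \<in> mor D Y Z\<rbrakk>
        \<Longrightarrow> shM D (g \<bullet> f) = shM D g \<bullet> shM D f"
    and sh_add:
      "\<lbrakk>X \<in> Obj D; Y \<in> Obj D; f \<in> mor D X Y; f' \<in> mor D X Y\<rbrakk>
        \<Longrightarrow> shM D (f \<oplus>\<^bsub>Hom D X Y\<^esub> f') = shM D f \<oplus>\<^bsub>Hom D (shO D X) (shO D Y)\<^esub> shM D f'"
    and sh_smult:
      "\<lbrakk>X \<in> Obj D; Y \<in> Obj D; f \<in> mor D X Y; a \<in> carrier K\<rbrakk>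
        \<Longrightarrow> shM D (a \<odot>\<^bsub>Hom D X Y\<^esub> f) = a \<odot>\<^bsub>Hom D (shO D X) (shO D Y)\<^esub> shM D f"
    and tri_typed:
      "dtri D X Y Z f g h \<Longrightarrow>
        X \<in> Obj D \<and> Y \<in> Obj D \<and> Z \<in> Obj D \<and>
        f \<in> mor D X Y \<and> g \<in> mor D Y Z \<and> h \<in> mor D Z (shO D X)"
    and TR1_iso:
      "\<lbrakk>dtri D X Y Z f g h; X' \<in> Obj D; Y' \<in> Obj D; Z' \<in> Obj D;
        f' \<in> mor D X' Y'; g' \<in> mor D Y' Z'; h' \<in> mor D Z' (shO D X');
        isomorphism D X X' \<alpha>; isomorphism D Y Y' \<beta>; isomorphism D Z Z' \<gamma>;
        \<beta> \<bullet> f = f' \<bullet> \<alpha>; \<gamma> \<bullet> g = g' \<bullet> \<beta>; shM D \<alpha> \<bullet> h = h' \<bullet> \<gamma>\<rbrakk>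
        \<Longrightarrow> dtri D X' Y' Z' f' g' h'"
    and TR1_id:
      "\<lbrakk>X \<in> Obj D; zero_object D N\<rbrakk>
        \<Longrightarrow> dtri D X X N (idm D X) (zero_mor D X N) (zero_mor D N (shO D X))"
    and TR1_cone:
      "\<lbrakk>X \<in> Obj D; Y \<in> Obj D; f \<in> mor D X Y\<rbrakk> \<Longrightarrow> \<exists>Z g h. dtri D X Y Z f g h"
    and TR2:
      "\<lbrakk>X \<in> Obj D; Y \<in> Obj D; Z \<in> Obj D;
        f \<in> mor D X Y; g \<in> mor D Y Z; h \<in> mor D Z (shO D X)\<rbrakk>
        \<Longrightarrow> dtri D X Y Z f g h \<longleftrightarrow>
            dtri D Y Z (shO D X) g h (\<ominus>\<^bsub>Hom D (shO D X) (shO D Y)\<^esub> shM D f)"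
    and TR3:
      "\<lbrakk>dtri D X Y Z f g h; dtri D X' Y' Z' f' g' h';
        \<alpha> \<in> mor D X X'; \<beta> \<in> mor D Y Y'; \<beta> \<bullet> f = f' \<bullet> \<alpha>\<rbrakk>
        \<Longrightarrow> \<exists>\<gamma> \<in> mor D Z Z'. \<gamma> \<bullet> g = g' \<bullet> \<beta> \<and> shM D \<alpha> \<bullet> h = h' \<bullet> \<gamma>"
    and TR4:
      "\<lbrakk>dtri D X Y Z' f p p'; dtri D Y Z X' g q q'; dtri D X Z Y' (g \<bullet> f) r r'\<rbrakk>
        \<Longrightarrow> \<exists>u v w. dtri D Z' Y' X' u v w \<and>
              u \<bullet> p = r \<bullet> g \<and> r' \<bullet> u = p' \<and>
              v \<bullet> r = q \<and> q' \<bullet> v = shM D f \<bullet> r' \<and>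
              w = shM D p \<bullet> q'"

definition left_homologically_finite ::
    "('k, 'r) ring_scheme \<Rightarrow> ('k, 'o, 'm, 'z) tricat_scheme \<Rightarrow> bool"
  where "left_homologically_finite K D \<longleftrightarrow>
    (\<forall>X \<in> Obj D. \<forall>Y \<in> Obj D.
      (\<forall>i. vectorspace.fin_dim K (Hom D ((shO D ^^ i) X) Y)) \<and>
      summable (\<lambda>i. real (vectorspace.dim K (Hom D ((shO D ^^ i) X) Y))))"


section \<open>Stability conditions\<close>

definition K0_relations :: "('k, 'o, 'm, 'z) tricat_scheme \<Rightarrow> ('o \<Rightarrow>\<^sub>0 int) set"
  where "K0_relations D =
    {frag_of Y - frag_of X - frag_of Z | X Y Z. \<exists>f g h. dtri D X Y Z f g h}"

definition K0 :: "('k, 'o, 'm, 'z) tricat_scheme \<Rightarrow> ('o \<Rightarrow>\<^sub>0 int) set monoid"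
  where "K0 D =
    free_Abelian_group (Obj D) Mod generate (free_Abelian_group (Obj D)) (K0_relations D)"

definition K0_class :: "('k, 'o, 'm, 'z) tricat_scheme \<Rightarrow> 'o \<Rightarrow> ('o \<Rightarrow>\<^sub>0 int) set"
  where "K0_class D X =
    generate (free_Abelian_group (Obj D)) (K0_relations D) #>\<^bsub>free_Abelian_group (Obj D)\<^esub> frag_of X"

definition complex_group :: "complex monoid"
  where "complex_group = \<lparr>carrier = UNIV, monoid.mult = (+), one = 0\<rparr>"

text \<open>Full subcategories are given by their sets of objects.\<close>

definition additive_subcategory :: "('k, 'o, 'm, 'z) lincat_scheme \<Rightarrow> 'o set \<Rightarrow> bool"
  where "additive_subcategory D A \<longleftrightarrow>
    A \<subseteq> Obj D \<and> (\<exists>X \<in> A. zero_object D X) \<and> (\<forall>X \<in> A. \<forall>Y \<in> A. \<exists>S \<in> A. direct_sum D S [X, Y])"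

definition extension_closed :: "('k, 'o, 'm, 'z) tricat_scheme \<Rightarrow> 'o set \<Rightarrow> bool"
  where "extension_closed D A \<longleftrightarrow>
    (\<forall>X Y Z f g h. dtri D X Y Z f g h \<longrightarrow> X \<in> A \<longrightarrow> Z \<in> A \<longrightarrow> Y \<in> A)"

text \<open>The objects, quotients and triangles of a filtration with \<open>n\<close> steps are \<open>M 0, \<dots>, M n\<close>,
  \<open>A 1, \<dots>, A n\<close> and \<open>M (i - 1) \<rightarrow> M i \<rightarrow> A i \<rightarrow> M (i - 1)[1]\<close>.\<close>

definition has_HN_filtration ::
    "('k, 'o, 'm, 'z) tricat_scheme \<Rightarrow> (real \<Rightarrow> 'o set) \<Rightarrow> 'o \<Rightarrow> bool"
  where "has_HN_filtration D P X \<longleftrightarrow>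
    (\<exists>(n::nat) M A \<phi> u v w.
      zero_object D (M 0) \<and> M n = X \<and>
      (\<forall>i \<in> {1..n}. dtri D (M (i - 1)) (M i) (A i) (u i) (v i) (w i) \<and>
                    A i \<in> P (\<phi> i) \<and> \<not> zero_object D (A i)) \<and>
      (\<forall>i j. 1 \<le> i \<longrightarrow> i < j \<longrightarrow> j \<le> n \<longrightarrow> \<phi> i > \<phi> j))"

text \<open>In the shift axiom, \<open>P(\<phi>)[1]\<close> is closed under isomorphism, as \<open>P(\<phi> + 1)\<close> is because of
  extension-closedness; if the shift is an automorphism, this is the image itself.\<close>

definition stability_condition ::
    "('k, 'o, 'm, 'z) tricat_scheme \<Rightarrow> (('o \<Rightarrow>\<^sub>0 int) set \<Rightarrow> complex) \<times> (real \<Rightarrow> 'o set) \<Rightarrow> bool"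
  where "stability_condition D = (\<lambda>(Z, P).
    Z \<in> hom (K0 D) complex_group \<and>
    (\<forall>\<phi>. additive_subcategory D (P \<phi>) \<and> extension_closed D (P \<phi>)) \<and>
    (\<forall>\<phi>. \<forall>X \<in> P \<phi>. \<not> zero_object D X \<longrightarrow>
       (\<exists>m::real. m > 0 \<and> Z (K0_class D X) = of_real m * exp (\<i> * of_real (pi * \<phi>)))) \<and>
    (\<forall>\<phi>. P (\<phi> + 1) = {Y. \<exists>X \<in> P \<phi>. iso_obj D (shO D X) Y}) \<and>
    (\<forall>\<phi> \<psi>. \<phi> > \<psi> \<longrightarrow> (\<forall>X \<in> P \<phi>. \<forall>Y \<in> P \<psi>. mor D X Y = {zero_mor D X Y})) \<and>
    (\<forall>X \<in> Obj D. \<not> zero_object D X \<longrightarrow> has_HN_filtration D P X))"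


section \<open>The derived Hall algebra\<close>

text \<open>A possibly infinite combination of basis elements \<open>u\<^sub>[\<^sub>M\<^sub>]\<close> is a function from
  isomorphism classes to \<^typ>\<open>rat\<close>; an isomorphism class is a set of objects.\<close>

definition iso_class :: "('k, 'o, 'm, 'z) lincat_scheme \<Rightarrow> 'o \<Rightarrow> 'o set"
  where "iso_class D X = {Y. iso_obj D X Y}"

definition iso_classes :: "('k, 'o, 'm, 'z) lincat_scheme \<Rightarrow> 'o set set"
  where "iso_classes D = iso_class D ` Obj D"

definition rep :: "'o set \<Rightarrow> 'o"
  where "rep C = (SOME X. X \<in> C)"

definition mor_with_cone :: "('k, 'o, 'm, 'z) tricat_scheme \<Rightarrow> 'o \<Rightarrow> 'o \<Rightarrow> 'o \<Rightarrow> 'm set"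
  where "mor_with_cone D L N E =
    {f \<in> mor D L N. \<exists>C g h. dtri D L N C f g h \<and> iso_obj D C E}"

definition hom_pairing :: "('k, 'o, 'm, 'z) tricat_scheme \<Rightarrow> 'o \<Rightarrow> 'o \<Rightarrow> rat"
  where "hom_pairing D L N =
    prod' (\<lambda>i::nat. of_nat (card (mor D ((shO D ^^ i) L) N)) powi ((- 1) ^ i)) {0<..}"

definition hall_number :: "('k, 'o, 'm, 'z) tricat_scheme \<Rightarrow> 'o \<Rightarrow> 'o \<Rightarrow> 'o \<Rightarrow> rat"
  where "hall_number D M N L =
    of_nat (card (mor_with_cone D L N (shO D M))) / of_nat (card (Units (End_ring D N)))
      * (hom_pairing D L N / hom_pairing D N N)"

text \<open>The bilinear extension of \<open>u\<^sub>[\<^sub>M\<^sub>] * u\<^sub>[\<^sub>N\<^sub>] = (\<Sum>[L]. F\<^sup>L\<^sub>M\<^sub>N u\<^sub>[\<^sub>L\<^sub>])\<close>, evaluated at a class. It is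
  meaningful where only finitely many terms are nonzero, which \<open>hall_mult_defined\<close> expresses;
  elsewhere \<^const>\<open>sum'\<close> is zero by convention.\<close>

definition hall_term ::
    "('k, 'o, 'm, 'z) tricat_scheme \<Rightarrow> ('o set \<Rightarrow> rat) \<Rightarrow> ('o set \<Rightarrow> rat) \<Rightarrow> 'o set \<Rightarrow>
     'o set \<times> 'o set \<Rightarrow> rat"
  where "hall_term D f g L = (\<lambda>(M, N). f M * g N * hall_number D (rep M) (rep N) (rep L))"

definition hall_mult ::
    "('k, 'o, 'm, 'z) tricat_scheme \<Rightarrow> ('o set \<Rightarrow> rat) \<Rightarrow> ('o set \<Rightarrow> rat) \<Rightarrow> 'o set \<Rightarrow> rat"
  where "hall_mult D f g L = sum' (hall_term D f g L) (iso_classes D \<times> iso_classes D)"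

definition hall_mult_defined ::
    "('k, 'o, 'm, 'z) tricat_scheme \<Rightarrow> ('o set \<Rightarrow> rat) \<Rightarrow> ('o set \<Rightarrow> rat) \<Rightarrow> bool"
  where "hall_mult_defined D f g \<longleftrightarrow>
    (\<forall>L \<in> iso_classes D.
       finite {MN \<in> iso_classes D \<times> iso_classes D. hall_term D f g L MN \<noteq> 0})"

definition hall_unit :: "('k, 'o, 'm, 'z) lincat_scheme \<Rightarrow> 'o set \<Rightarrow> rat"
  where "hall_unit D C = of_bool (\<exists>X. zero_object D X \<and> C = iso_class D X)"

text \<open>\<open>f\<^sub>1 * f\<^sub>2 * \<dots> * f\<^sub>s\<close>, bracketed from the left.\<close>

definition hall_prod ::
    "('k, 'o, 'm, 'z) tricat_scheme \<Rightarrow> ('o set \<Rightarrow> rat) list \<Rightarrow> 'o set \<Rightarrow> rat"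
  where "hall_prod D fs =
    (case fs of [] \<Rightarrow> hall_unit D | f # fs' \<Rightarrow> foldl (hall_mult D) f fs')"

definition hall_prod_defined ::
    "('k, 'o, 'm, 'z) tricat_scheme \<Rightarrow> ('o set \<Rightarrow> rat) list \<Rightarrow> bool"
  where "hall_prod_defined D fs \<longleftrightarrow>
    (\<forall>i. 0 < i \<longrightarrow> i < length fs \<longrightarrow> hall_mult_defined D (hall_prod D (take i fs)) (fs ! i))"

text \<open>The lists \<open>[\<phi>\<^sub>1, \<dots>, \<phi>\<^sub>s]\<close> with \<open>s \<ge> 1\<close> and \<open>\<phi>\<^sub>1 > \<dots> > \<phi>\<^sub>s\<close>.\<close>

definition descending_phases :: "real list set"
  where "descending_phases = {\<phi>s. \<phi>s \<noteq> [] \<and> sorted_wrt (>) \<phi>s}"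

definition descending_term ::
    "('k, 'o, 'm, 'z) tricat_scheme \<Rightarrow> (real \<Rightarrow> 'o set \<Rightarrow> rat) \<Rightarrow> 'o set \<Rightarrow> real list \<Rightarrow> rat"
  where "descending_term D S L \<phi>s = hall_prod D (map (\<lambda>\<phi> C. S \<phi> C - hall_unit D C) \<phi>s) L"

definition descending_product ::
    "('k, 'o, 'm, 'z) tricat_scheme \<Rightarrow> (real \<Rightarrow> 'o set \<Rightarrow> rat) \<Rightarrow> 'o set \<Rightarrow> rat"
  where "descending_product D S L =
    hall_unit D L + sum' (descending_term D S L) descending_phases"

definition descending_product_defined ::
    "('k, 'o, 'm, 'z) tricat_scheme \<Rightarrow> (real \<Rightarrow> 'o set \<Rightarrow> rat) \<Rightarrow> bool"
  where "descending_product_defined D S \<longleftrightarrow>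
    (\<forall>\<phi>s \<in> descending_phases. hall_prod_defined D (map (\<lambda>\<phi> C. S \<phi> C - hall_unit D C) \<phi>s)) \<and>
    (\<forall>L \<in> iso_classes D. finite {\<phi>s \<in> descending_phases. descending_term D S L \<phi>s \<noteq> 0})"

definition SS ::
    "('k, 'o, 'm, 'z) lincat_scheme \<Rightarrow> ('c \<times> (real \<Rightarrow> 'o set)) \<Rightarrow> real \<Rightarrow> 'o set \<Rightarrow> rat"
  where "SS D \<sigma> \<phi> C = of_bool (\<exists>X \<in> snd \<sigma> \<phi>. C = iso_class D X)"

definition one_cat :: "('k, 'o, 'm, 'z) lincat_scheme \<Rightarrow> 'o set \<Rightarrow> rat"
  where "one_cat D C = of_bool (C \<in> iso_classes D)"

end

theory Submission
  imports Defs
begin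

text \<open>
  Expand the product. The claim is that for \<open>\<phi>\<^sub>1 > \<dots> > \<phi>\<^sub>s\<close> the summand
  \<open>(SS\<^sub>\<phi>\<^sub>1 - 1) * \<dots> * (SS\<^sub>\<phi>\<^sub>s - 1)\<close> is the characteristic function of the objects whose
  Harder-Narasimhan filtration has phases exactly \<open>\<phi>\<^sub>1, \<dots>, \<phi>\<^sub>s\<close> (\<open>hall_prod_eq_HN_type\<close>). Every
  object has exactly one sequence of phases (\<open>HN_type_exists\<close>, \<open>HN_type_unique\<close>), the empty one
  belonging to the zero objects and to the leading 1 of the product. So at each isomorphism class exactly
  one summand takes the value 1 and all others vanish.

  The claim goes by induction on \<open>s\<close>, splitting off the last factor of the filtration, that of smallest
  phase. Let \<open>M\<close> have phases \<open>\<phi>\<^sub>1, \<dots>, \<phi>\<^sub>s\<^sub>-\<^sub>1\<close> and let \<open>N\<close> be semistable of phase \<open>\<phi>\<^sub>s\<close>. Since shifting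
  raises phases, \<open>Hom(M[i], N) = 0\<close> for all \<open>i \<ge> 0\<close> (\<open>HN_type_orthogonal\<close>). Hence in a triangle
  \<open>M \<rightarrow> L \<rightarrow> N \<rightarrow> M[1]\<close> with \<open>g : L \<rightarrow> N\<close>, composition with \<open>g[i]\<close> is a bijection from \<open>Hom(N[i], W)\<close> to
  \<open>Hom(L[i], W)\<close>, for all \<open>i \<ge> 0\<close> and all \<open>W\<close> semistable of phase \<open>\<phi>\<^sub>s\<close>, by the long exact sequence
  (\<open>orthogonal_precomp_bij_betw\<close>). This has three consequences.

  \<^item> The triangle is determined up to isomorphism by \<open>L\<close> (\<open>quotient_unique\<close>, \<open>subobject_unique\<close>), so
    the sum defining the product at \<open>L\<close> has at most one nonzero term.

  \<^item> The morphisms \<open>L \<rightarrow> N\<close> with cone \<open>M[1]\<close> are exactly the \<open>a g\<close> with \<open>a \<in> Aut N\<close>, each obtained once, so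
    that there are \<open>|Aut N|\<close> of them (\<open>automorphisms_bij_mor_with_cone\<close>).

  \<^item> \<open>{L, N} = {N, N}\<close> factor by factor (\<open>hom_pairing_eq\<close>).

  The last two say that the Hall number of the one surviving term is 1 (\<open>hall_number_orthogonal\<close>).
\<close>

section \<open>Morphisms in a linear category\<close>

context linear_category
begin

lemma hom_abelian_group: "\<lbrakk>X \<in> Obj D; Y \<in> Obj D\<rbrakk> \<Longrightarrow> abelian_group (Hom D X Y)"
  by (meson hom_vectorspace module.axioms(2) vectorspace.axioms(1))

lemma zero_mor_closed: "\<lbrakk>X \<in> Obj D; Y \<in> Obj D\<rbrakk> \<Longrightarrow> zero_mor D X Y \<in> mor D X Y"
  by (meson hom_abelian_group abelian_monoid.zero_closed abelian_group.axioms(1))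

lemma cmp_zero_left:
  assumes "X \<in> Obj D" "Y \<in> Obj D" "Z \<in> Obj D" "f \<in> mor D X Y"
  shows "zero_mor D Y Z \<bullet> f = zero_mor D X Z"
proof -
  interpret YZ: abelian_group "Hom D Y Z" using assms hom_abelian_group by blast
  interpret XZ: abelian_group "Hom D X Z" using assms hom_abelian_group by blast
  have c: "zero_mor D Y Z \<bullet> f \<in> mor D X Z" using assms cmp_mor YZ.zero_closed by blast
  have "zero_mor D Y Z \<bullet> f = (zero_mor D Y Z \<bullet> f) \<oplus>\<^bsub>Hom D X Z\<^esub> (zero_mor D Y Z \<bullet> f)"
    using cmp_add_left[OF assms(1-4), of "zero_mor D Y Z" "zero_mor D Y Z"] by simp
  thus ?thesis using c XZ.add.r_cancel_one' by simp
qed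

lemma cmp_zero_right:
  assumes "X \<in> Obj D" "Y \<in> Obj D" "Z \<in> Obj D" "g \<in> mor D Y Z"
  shows "g \<bullet> zero_mor D X Y = zero_mor D X Z"
proof -
  interpret XY: abelian_group "Hom D X Y" using assms hom_abelian_group by blast
  interpret XZ: abelian_group "Hom D X Z" using assms hom_abelian_group by blast
  have c: "g \<bullet> zero_mor D X Y \<in> mor D X Z" using assms cmp_mor XY.zero_closed by blast
  have "g \<bullet> zero_mor D X Y = (g \<bullet> zero_mor D X Y) \<oplus>\<^bsub>Hom D X Z\<^esub> (g \<bullet> zero_mor D X Y)"
    using cmp_add_right[OF assms(1-3) _ _ assms(4), of "zero_mor D X Y" "zero_mor D X Y"] by simp
  thus ?thesis using c XZ.add.r_cancel_one' by simp
qed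

lemma cmp_minus_left:
  assumes "X \<in> Obj D" "Y \<in> Obj D" "Z \<in> Obj D" "f \<in> mor D X Y" "g \<in> mor D Y Z"
  shows "(\<ominus>\<^bsub>Hom D Y Z\<^esub> g) \<bullet> f = \<ominus>\<^bsub>Hom D X Z\<^esub> (g \<bullet> f)"
proof -
  interpret YZ: abelian_group "Hom D Y Z" using assms hom_abelian_group by blast
  interpret XZ: abelian_group "Hom D X Z" using assms hom_abelian_group by blast
  have "((\<ominus>\<^bsub>Hom D Y Z\<^esub> g) \<bullet> f) \<oplus>\<^bsub>Hom D X Z\<^esub> (g \<bullet> f) = zero_mor D X Z"
    using cmp_add_left[OF assms(1-4), of "\<ominus>\<^bsub>Hom D Y Z\<^esub> g" g] assms cmp_zero_left YZ.l_neg by simp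
  thus ?thesis using assms cmp_mor[of X Y Z] XZ.minus_equality YZ.a_inv_closed by simp
qed

lemma cmp_minus_right:
  assumes "X \<in> Obj D" "Y \<in> Obj D" "Z \<in> Obj D" "f \<in> mor D X Y" "g \<in> mor D Y Z"
  shows "g \<bullet> (\<ominus>\<^bsub>Hom D X Y\<^esub> f) = \<ominus>\<^bsub>Hom D X Z\<^esub> (g \<bullet> f)"
proof -
  interpret XY: abelian_group "Hom D X Y" using assms hom_abelian_group by blast
  interpret XZ: abelian_group "Hom D X Z" using assms hom_abelian_group by blast
  have "(g \<bullet> (\<ominus>\<^bsub>Hom D X Y\<^esub> f)) \<oplus>\<^bsub>Hom D X Z\<^esub> (g \<bullet> f) = zero_mor D X Z"
    using cmp_add_right[OF assms(1-3) _ _ assms(5), of "\<ominus>\<^bsub>Hom D X Y\<^esub> f" f] assms cmp_zero_right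
      XY.l_neg by simp
  thus ?thesis using assms cmp_mor[of X Y Z] XZ.minus_equality XY.a_inv_closed by simp
qed

lemma cmp_diff_left:
  assumes "X \<in> Obj D" "Y \<in> Obj D" "Z \<in> Obj D" "f \<in> mor D X Y" "g \<in> mor D Y Z" "g' \<in> mor D Y Z"
  shows "(g \<ominus>\<^bsub>Hom D Y Z\<^esub> g') \<bullet> f = (g \<bullet> f) \<ominus>\<^bsub>Hom D X Z\<^esub> (g' \<bullet> f)"
proof -
  interpret YZ: abelian_group "Hom D Y Z" using assms hom_abelian_group by blast
  show ?thesis using assms cmp_add_left cmp_minus_left by (simp add: a_minus_def)
qed

lemma cmp_diff_right:
  assumes "X \<in> Obj D" "Y \<in> Obj D" "Z \<in> Obj D" "f \<in> mor D X Y" "f' \<in> mor D X Y" "g \<in> mor D Y Z"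
  shows "g \<bullet> (f \<ominus>\<^bsub>Hom D X Y\<^esub> f') = (g \<bullet> f) \<ominus>\<^bsub>Hom D X Z\<^esub> (g \<bullet> f')"
proof -
  interpret XY: abelian_group "Hom D X Y" using assms hom_abelian_group by blast
  show ?thesis using assms cmp_add_right cmp_minus_right by (simp add: a_minus_def)
qed

lemma zero_object_Obj: "zero_object D X \<Longrightarrow> X \<in> Obj D"
  unfolding zero_object_def by blast

lemma mor_from_zero_object:
  assumes "zero_object D X" "Y \<in> Obj D" shows "mor D X Y = {zero_mor D X Y}"
  using assms zero_mor_closed[of X Y] unfolding zero_object_def by blast

lemma zero_object_iff_id_eq_zero:
  assumes "X \<in> Obj D"
  shows "zero_object D X \<longleftrightarrow> idm D X = zero_mor D X X"
proof
  assume "zero_object D X"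
  thus "idm D X = zero_mor D X X" using mor_from_zero_object assms id_mor by blast
next
  assume i: "idm D X = zero_mor D X X"
  have "f = zero_mor D X Y" if "Y \<in> Obj D" "f \<in> mor D X Y" for f Y
    using that id_right[of X Y f] cmp_zero_right[of X X Y f] assms i by simp
  moreover have "f = zero_mor D Y X" if "Y \<in> Obj D" "f \<in> mor D Y X" for f Y
    using that id_left[of Y X f] cmp_zero_left[of Y X X f] assms i by simp
  ultimately show "zero_object D X" unfolding zero_object_def using assms zero_mor_closed by blast
qed

lemma isomorphism_id: "X \<in> Obj D \<Longrightarrow> isomorphism D X X (idm D X)"
  unfolding isomorphism_def using id_mor id_left by blast

lemma isomorphism_cmp:
  assumes "X \<in> Obj D" "Y \<in> Obj D" "Z \<in> Obj D" "isomorphism D X Y f" "isomorphism D Y Z g"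
  shows "isomorphism D X Z (g \<bullet> f)"
proof -
  obtain f' g' where f: "f \<in> mor D X Y" "f' \<in> mor D Y X" "f' \<bullet> f = idm D X" "f \<bullet> f' = idm D Y"
    and g: "g \<in> mor D Y Z" "g' \<in> mor D Z Y" "g' \<bullet> g = idm D Y" "g \<bullet> g' = idm D Z"
    using assms unfolding isomorphism_def by blast
  have gf: "g \<bullet> f \<in> mor D X Z" and fg: "f' \<bullet> g' \<in> mor D Z X"
    using assms f g cmp_mor by blast+
  have "(f' \<bullet> g') \<bullet> (g \<bullet> f) = f' \<bullet> (g' \<bullet> (g \<bullet> f))"
    using assms(1-3) f g gf by (intro cmp_assoc)
  also have "g' \<bullet> (g \<bullet> f) = f"
    using cmp_assoc[of X Y Z Y f g g'] id_left[of X Y f] assms(1-3) f g by simp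
  finally have "(f' \<bullet> g') \<bullet> (g \<bullet> f) = idm D X" using f by simp
  moreover have "(g \<bullet> f) \<bullet> (f' \<bullet> g') = g \<bullet> (f \<bullet> (f' \<bullet> g'))"
    using assms(1-3) f g fg by (intro cmp_assoc)
  moreover have "f \<bullet> (f' \<bullet> g') = g'"
    using cmp_assoc[of Z Y X Y g' f' f] id_left[of Z Y g'] assms(1-3) f g by simp
  ultimately show ?thesis unfolding isomorphism_def using g gf fg by auto
qed

lemma iso_obj_refl: "X \<in> Obj D \<Longrightarrow> iso_obj D X X"
  unfolding iso_obj_def using isomorphism_id by blast

lemma iso_obj_sym: "iso_obj D X Y \<Longrightarrow> iso_obj D Y X"
  unfolding iso_obj_def isomorphism_def by blast

lemma iso_obj_trans: "\<lbrakk>iso_obj D X Y; iso_obj D Y Z\<rbrakk> \<Longrightarrow> iso_obj D X Z"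
  unfolding iso_obj_def using isomorphism_cmp by blast

lemma iso_class_eq_iff:
  assumes "X \<in> Obj D" shows "iso_class D X = iso_class D Y \<longleftrightarrow> iso_obj D X Y"
  unfolding iso_class_def using assms iso_obj_refl iso_obj_sym iso_obj_trans by blast

lemma rep_iso_class:
  assumes "C \<in> iso_classes D" shows "rep C \<in> Obj D" "iso_class D (rep C) = C"
proof -
  obtain X where X: "X \<in> Obj D" "C = iso_class D X" using assms unfolding iso_classes_def by blast
  hence "X \<in> C" unfolding iso_class_def using iso_obj_refl by blast
  hence "rep C \<in> C" unfolding rep_def by (rule someI)
  hence i: "iso_obj D X (rep C)" using X unfolding iso_class_def by blast
  thus "rep C \<in> Obj D" unfolding iso_obj_def by blast
  show "iso_class D (rep C) = C" using i X iso_class_eq_iff by blast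
qed

lemma iso_obj_zero_object:
  assumes "zero_object D X" "zero_object D Y" shows "iso_obj D X Y"
proof -
  have X: "X \<in> Obj D" and Y: "Y \<in> Obj D" using assms zero_object_Obj by auto
  have "zero_mor D Y X \<bullet> zero_mor D X Y = idm D X" "zero_mor D X Y \<bullet> zero_mor D Y X = idm D Y"
    using X Y assms zero_object_iff_id_eq_zero cmp_zero_left zero_mor_closed by simp_all
  thus ?thesis unfolding iso_obj_def isomorphism_def using X Y zero_mor_closed by blast
qed

lemma zero_object_iso_obj:
  assumes "zero_object D X" "iso_obj D X Y" shows "zero_object D Y"
proof -
  have X: "X \<in> Obj D" and Y: "Y \<in> Obj D" using assms unfolding iso_obj_def by auto
  obtain f g where f: "f \<in> mor D X Y" "g \<in> mor D Y X" "f \<bullet> g = idm D Y"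
    using assms unfolding iso_obj_def isomorphism_def by blast
  have "f = zero_mor D X Y" using f mor_from_zero_object assms Y by blast
  hence "idm D Y = zero_mor D Y Y" using f X Y cmp_zero_left[of Y X Y g] by simp
  thus ?thesis using Y zero_object_iff_id_eq_zero by blast
qed

lemma Units_End_ring_iff: "a \<in> Units (End_ring D X) \<longleftrightarrow> isomorphism D X X a"
  unfolding Units_def End_ring_def isomorphism_def by auto

text \<open>Over a finite field a finite spanning set has only finitely many coefficient families.\<close>

lemma finite_mor:
  assumes "finite (carrier K)" "X \<in> Obj D" "Y \<in> Obj D" "vectorspace.fin_dim K (Hom D X Y)"
  shows "finite (mor D X Y)"
proof -
  interpret V: vectorspace K "Hom D X Y" using assms hom_vectorspace by blast
  obtain B where B: "finite B" "B \<subseteq> mor D X Y" "V.span B = mor D X Y"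
    using assms(4) unfolding V.fin_dim_def by blast
  have "mor D X Y \<subseteq> (\<lambda>a. V.lincomb a B) ` (B \<rightarrow>\<^sub>E carrier K)"
  proof
    fix f assume "f \<in> mor D X Y"
    then obtain a where a: "f = V.lincomb a B" "a \<in> B \<rightarrow> carrier K"
      using B V.finite_span[of B] by blast
    have "V.lincomb (restrict a B) B = f"
      unfolding a(1) by (rule V.lincomb_cong) (use B a in auto)
    moreover have "restrict a B \<in> B \<rightarrow>\<^sub>E carrier K" using a by auto
    ultimately show "f \<in> (\<lambda>a. V.lincomb a B) ` (B \<rightarrow>\<^sub>E carrier K)" by blast
  qed
  moreover have "finite (B \<rightarrow>\<^sub>E carrier K)" using B assms by (intro finite_PiE) auto
  ultimately show ?thesis using finite_surj by blast
qed

end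

section \<open>Long exact sequences of Hom spaces\<close>

context triangulated_category
begin

lemma sh_mor: "\<lbrakk>X \<in> Obj D; Y \<in> Obj D; f \<in> mor D X Y\<rbrakk> \<Longrightarrow> shM D f \<in> mor D (shO D X) (shO D Y)"
  by (rule bij_betw_apply[OF sh_fully_faithful])

lemma sh_zero:
  assumes "X \<in> Obj D" "Y \<in> Obj D"
  shows "shM D (zero_mor D X Y) = zero_mor D (shO D X) (shO D Y)"
proof -
  interpret A: abelian_group "Hom D X Y" using assms hom_abelian_group by blast
  interpret B: abelian_group "Hom D (shO D X) (shO D Y)" using assms hom_abelian_group sh_obj by blast
  have "shM D (zero_mor D X Y) \<oplus>\<^bsub>Hom D (shO D X) (shO D Y)\<^esub> shM D (zero_mor D X Y)
      = shM D (zero_mor D X Y)"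
    using sh_add[OF assms A.zero_closed A.zero_closed] by simp
  thus ?thesis using sh_mor[OF assms A.zero_closed] B.add.r_cancel_one' by simp
qed

lemma sh_inject:
  assumes "X \<in> Obj D" "Y \<in> Obj D" "f \<in> mor D X Y" "g \<in> mor D X Y" "shM D f = shM D g"
  shows "f = g"
  using inj_onD[OF bij_betw_imp_inj_on[OF sh_fully_faithful[OF assms(1,2)]] assms(5,3,4)] .

lemma shift_zero_object: "zero_object D X \<Longrightarrow> zero_object D (shO D X)"
proof -
  assume 0: "zero_object D X"
  have X: "X \<in> Obj D" using 0 zero_object_Obj by blast
  show "zero_object D (shO D X)"
    using 0 zero_object_iff_id_eq_zero[OF X] zero_object_iff_id_eq_zero[OF sh_obj[OF X]]
      sh_id[OF X] sh_zero[OF X X] by simp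
qed

lemma funpow_shift_obj: "X \<in> Obj D \<Longrightarrow> (shO D ^^ i) X \<in> Obj D"
  by (induction i) (simp_all add: sh_obj)

lemma funpow_shift_zero_object: "zero_object D X \<Longrightarrow> zero_object D ((shO D ^^ i) X)"
  by (induction i) (simp_all add: shift_zero_object)

lemma iso_obj_unshift:
  assumes "X \<in> Obj D" "Y \<in> Obj D" "iso_obj D (shO D X) (shO D Y)"
  shows "iso_obj D X Y"
proof -
  obtain u v where u: "u \<in> mor D (shO D X) (shO D Y)" and v: "v \<in> mor D (shO D Y) (shO D X)"
    and vu: "v \<bullet> u = idm D (shO D X)" and uv: "u \<bullet> v = idm D (shO D Y)"
    using assms(3) unfolding iso_obj_def isomorphism_def by blast
  obtain f where f: "f \<in> mor D X Y" "u = shM D f"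
    using u sh_fully_faithful[OF assms(1,2)] unfolding bij_betw_def by blast
  obtain g where g: "g \<in> mor D Y X" "v = shM D g"
    using v sh_fully_faithful[OF assms(2,1)] unfolding bij_betw_def by blast
  have "shM D (g \<bullet> f) = shM D (idm D X)" "shM D (f \<bullet> g) = shM D (idm D Y)"
    using assms f g vu uv sh_cmp sh_id by simp_all
  moreover have "g \<bullet> f \<in> mor D X X" "f \<bullet> g \<in> mor D Y Y" using assms f g cmp_mor by blast+
  ultimately have "g \<bullet> f = idm D X" "f \<bullet> g = idm D Y"
    using sh_inject[OF assms(1,1) _ id_mor[OF assms(1)]] sh_inject[OF assms(2,2) _ id_mor[OF assms(2)]]
    by blast+
  thus ?thesis unfolding iso_obj_def isomorphism_def using f g assms by blast
qed

lemma triangle_rotate: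
  assumes "dtri D X Y Z f g h"
  shows "dtri D Y Z (shO D X) g h (\<ominus>\<^bsub>Hom D (shO D X) (shO D Y)\<^esub> shM D f)"
  using TR2[of X Y Z f g h] tri_typed[OF assms] assms by simp

text \<open>Three rotations shift a triangle and change the signs of its morphisms. Only the existence of
  a triangle on the shifted objects matters below, so the signs are not recorded.\<close>

lemma triangle_shift:
  assumes "dtri D X Y Z f g h" shows "\<exists>f' g' h'. dtri D (shO D X) (shO D Y) (shO D Z) f' g' h'"
  using triangle_rotate[OF triangle_rotate[OF triangle_rotate[OF assms]]] by blast

lemma triangle_funpow_shift:
  assumes "dtri D X Y Z f g h"
  shows "\<exists>f' g' h'. dtri D ((shO D ^^ i) X) ((shO D ^^ i) Y) ((shO D ^^ i) Z) f' g' h'"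
proof (induction i)
  case 0
  show ?case using assms by auto
next
  case (Suc i)
  then show ?case using triangle_shift by fastforce
qed

lemma triangle_zero_id:
  assumes "X \<in> Obj D" "zero_object D N"
  shows "dtri D N X X (zero_mor D N X) (idm D X) (zero_mor D X (shO D N))"
proof -
  have N: "N \<in> Obj D" and sN: "zero_object D (shO D N)" "shO D N \<in> Obj D"
    using assms zero_object_Obj shift_zero_object by auto
  interpret B: abelian_group "Hom D (shO D N) (shO D X)" using assms sN hom_abelian_group sh_obj by blast
  have "\<ominus>\<^bsub>Hom D (shO D N) (shO D X)\<^esub> shM D (zero_mor D N X) = zero_mor D (shO D N) (shO D X)"
    using sh_zero[OF N assms(1)] by simp
  hence "dtri D X X (shO D N) (idm D X) (zero_mor D X (shO D N))
      (\<ominus>\<^bsub>Hom D (shO D N) (shO D X)\<^esub> shM D (zero_mor D N X))"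
    using TR1_id[OF assms(1) sN(1)] by simp
  thus ?thesis using TR2[OF N assms(1,1) zero_mor_closed id_mor zero_mor_closed] assms N sN by blast
qed

text \<open>Exactness of \<open>Hom(_, W)\<close> at \<open>Y\<close>: a morphism that kills \<open>f\<close> extends to a morphism to the triangle
  \<open>0 \<rightarrow> W \<rightarrow> W \<rightarrow> 0[1]\<close>, and the fill-in is the factorization through \<open>g\<close>.\<close>

lemma triangle_weak_cokernel:
  assumes T: "dtri D X Y Z f g h" and W: "W \<in> Obj D" and q: "q \<in> mor D Y W"
    and 0: "q \<bullet> f = zero_mor D X W"
  shows "\<exists>s \<in> mor D Z W. s \<bullet> g = q"
proof -
  obtain N where N: "zero_object D N" using zero_object_exists by blast
  have t: "X \<in> Obj D" "Y \<in> Obj D" "N \<in> Obj D"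
    using tri_typed[OF T] zero_object_Obj[OF N] by auto
  have "q \<bullet> f = zero_mor D N W \<bullet> zero_mor D X N"
    using cmp_zero_left[of X N W] 0 t W zero_mor_closed by simp
  then obtain s where "s \<in> mor D Z W" "s \<bullet> g = idm D W \<bullet> q"
    using TR3[OF T triangle_zero_id[OF W N] zero_mor_closed q] t by blast
  thus ?thesis using id_left[of Y W q] t W q by auto
qed

text \<open>Exactness of \<open>Hom(W, _)\<close> at \<open>Y\<close>, by comparison with the triangle \<open>W \<rightarrow> W \<rightarrow> 0 \<rightarrow> W[1]\<close>.\<close>

lemma triangle_weak_kernel:
  assumes T: "dtri D X Y Z f g h" and W: "W \<in> Obj D" and q: "q \<in> mor D W Y"
    and 0: "g \<bullet> q = zero_mor D W Z"
  shows "\<exists>s \<in> mor D W X. f \<bullet> s = q"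
proof -
  obtain N where N: "zero_object D N" using zero_object_exists by blast
  have t: "X \<in> Obj D" "Y \<in> Obj D" "Z \<in> Obj D" "f \<in> mor D X Y" "N \<in> Obj D" "shO D X \<in> Obj D"
    "shO D Y \<in> Obj D" "shO D W \<in> Obj D"
    using tri_typed[OF T] zero_object_Obj[OF N] sh_obj W by auto
  interpret WW: abelian_group "Hom D (shO D W) (shO D W)" using t hom_abelian_group by blast
  interpret WY: abelian_group "Hom D (shO D W) (shO D Y)" using t hom_abelian_group by blast
  have iW: "idm D (shO D W) \<in> mor D (shO D W) (shO D W)" using t id_mor by blast
  have "zero_mor D N Z \<bullet> zero_mor D W N = g \<bullet> q"
    using cmp_zero_left[of W N Z] 0 t W zero_mor_closed by simp
  \<comment> \<open>The fill-in is produced between the triangles rotated once, so it is a shifted morphism.\<close>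
  then obtain c where c: "c \<in> mor D (shO D W) (shO D X)"
    "shM D q \<bullet> (\<ominus>\<^bsub>Hom D (shO D W) (shO D W)\<^esub> shM D (idm D W))
      = (\<ominus>\<^bsub>Hom D (shO D X) (shO D Y)\<^esub> shM D f) \<bullet> c"
    using TR3[OF triangle_rotate[OF TR1_id[OF W N]] triangle_rotate[OF T] q
        zero_mor_closed[of N Z]] t by blast
  obtain s where s: "s \<in> mor D W X" "c = shM D s"
    using c(1) sh_fully_faithful[OF W t(1)] unfolding bij_betw_def by blast
  have sq: "shM D q \<in> mor D (shO D W) (shO D Y)" and sf: "shM D f \<in> mor D (shO D X) (shO D Y)"
    using W t q sh_mor by blast+
  have fs: "f \<bullet> s \<in> mor D W Y" "shM D f \<bullet> c \<in> mor D (shO D W) (shO D Y)"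
    using W t s sf c cmp_mor by blast+
  have "\<ominus>\<^bsub>Hom D (shO D W) (shO D Y)\<^esub> shM D q = \<ominus>\<^bsub>Hom D (shO D W) (shO D Y)\<^esub> (shM D f \<bullet> c)"
    using c(2) cmp_minus_right[OF t(8,8,7) iW sq] cmp_minus_left[OF t(8,6,7) c(1) sf]
      id_right[OF t(8,7) sq] sh_id[OF W] by simp
  hence "shM D q = shM D f \<bullet> c" using sq fs by (metis WY.minus_minus)
  also have "\<dots> = shM D (f \<bullet> s)" using sh_cmp[OF W t(1,2) s(1) t(4)] s(2) by simp
  finally have "f \<bullet> s = q"
    using sh_inject[OF W t(2) fs(1) q] by simp
  thus ?thesis using s by blast
qed

text \<open>The part \<open>Hom(X[1], W) \<rightarrow> Hom(Z, W) \<rightarrow> Hom(Y, W) \<rightarrow> Hom(X, W)\<close> of the long exact sequence,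
  with vanishing outer terms.\<close>

lemma triangle_precomp_bij_betw:
  assumes T: "dtri D X Y Z f g h" and W: "W \<in> Obj D"
    and X0: "mor D X W = {zero_mor D X W}"
    and X1: "mor D (shO D X) W = {zero_mor D (shO D X) W}"
  shows "bij_betw (\<lambda>s. s \<bullet> g) (mor D Z W) (mor D Y W)"
proof (rule bij_betw_imageI)
  have t: "X \<in> Obj D" "Y \<in> Obj D" "Z \<in> Obj D" "f \<in> mor D X Y" "g \<in> mor D Y Z"
    "h \<in> mor D Z (shO D X)"
    using tri_typed[OF T] by simp_all
  have sX: "shO D X \<in> Obj D" using sh_obj[OF t(1)] .
  interpret ZW: abelian_group "Hom D Z W" by (rule hom_abelian_group[OF t(3) W])
  interpret YW: abelian_group "Hom D Y W" by (rule hom_abelian_group[OF t(2) W])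
  show "inj_on (\<lambda>s. s \<bullet> g) (mor D Z W)"
  proof (rule inj_onI)
    fix s s' assume s: "s \<in> mor D Z W" "s' \<in> mor D Z W" "s \<bullet> g = s' \<bullet> g"
    have d: "s \<ominus>\<^bsub>Hom D Z W\<^esub> s' \<in> mor D Z W" by (rule ZW.minus_closed[OF s(1,2)])
    have "(s \<ominus>\<^bsub>Hom D Z W\<^esub> s') \<bullet> g = (s' \<bullet> g) \<ominus>\<^bsub>Hom D Y W\<^esub> (s' \<bullet> g)"
      using cmp_diff_left[OF t(2,3) W t(5) s(1,2)] s(3) by simp
    also have "\<dots> = zero_mor D Y W" 
      using YW.r_neg[OF cmp_mor[OF t(2,3) W t(5) s(2)]] unfolding a_minus_def .
    finally obtain r where r: "r \<in> mor D (shO D X) W" "r \<bullet> h = s \<ominus>\<^bsub>Hom D Z W\<^esub> s'"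
      using triangle_weak_cokernel[OF triangle_rotate[OF T] W d] by blast
    from r(1) have "r = zero_mor D (shO D X) W" unfolding X1 by (rule singletonD)
    hence "s \<ominus>\<^bsub>Hom D Z W\<^esub> s' = zero_mor D Z W"
      using r(2) cmp_zero_left[OF t(3) sX W t(6)] by simp
    hence "\<ominus>\<^bsub>Hom D Z W\<^esub> (\<ominus>\<^bsub>Hom D Z W\<^esub> s') = s"
      using ZW.minus_equality[of s "\<ominus>\<^bsub>Hom D Z W\<^esub> s'"] s(1,2) unfolding a_minus_def by simp
    thus "s = s'" using ZW.minus_minus[OF s(2)] by simp
  qed
  show "(\<lambda>s. s \<bullet> g) ` mor D Z W = mor D Y W"
  proof (intro equalityI subsetI)
    fix q assume "q \<in> (\<lambda>s. s \<bullet> g) ` mor D Z W"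
    thus "q \<in> mor D Y W" using cmp_mor[OF t(2,3) W t(5)] by blast
  next
    fix q assume q: "q \<in> mor D Y W"
    have "q \<bullet> f = zero_mor D X W"
      using cmp_mor[OF t(1,2) W t(4) q] unfolding X0 by (rule singletonD)
    thus "q \<in> (\<lambda>s. s \<bullet> g) ` mor D Z W" using triangle_weak_cokernel[OF T W q] by blast
  qed
qed

end

section \<open>Triangles with orthogonal outer terms\<close>

text \<open>In the bijection \<open>Hom(N[i], W) \<rightarrow> Hom(L[i], W)\<close> given by a triangle \<open>M \<rightarrow> L \<rightarrow> N \<rightarrow> M[1]\<close>, surjectivity
  uses the vanishing of \<open>Hom(M[i], W)\<close> and injectivity that of \<open>Hom(M[i + 1], W)\<close>; only nonnegative
  shifts enter.\<close>

definition shift_orthogonal :: "('k, 'o, 'm, 'z) tricat_scheme \<Rightarrow> 'o \<Rightarrow> 'o \<Rightarrow> bool"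
  where "shift_orthogonal D M N \<longleftrightarrow>
    (\<forall>i. mor D ((shO D ^^ i) M) N = {zero_mor D ((shO D ^^ i) M) N})"

context triangulated_category
begin

lemma shift_orthogonalD:
  assumes "shift_orthogonal D M N"
  shows "mor D M N = {zero_mor D M N}" "mor D (shO D M) N = {zero_mor D (shO D M) N}"
  using assms[unfolded shift_orthogonal_def, rule_format, of 0]
    assms[unfolded shift_orthogonal_def, rule_format, of 1] by simp_all

lemma orthogonal_precomp_bij_betw:
  assumes "dtri D M L N f g h" "shift_orthogonal D M W" "W \<in> Obj D"
  shows "bij_betw (\<lambda>s. s \<bullet> g) (mor D N W) (mor D L W)"
  using triangle_precomp_bij_betw[OF assms(1,3)] shift_orthogonalD[OF assms(2)] by simp

lemma orthogonal_epi:
  assumes "dtri D M L N f g h" "shift_orthogonal D M W" "W \<in> Obj D"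
    "s \<in> mor D N W" "s' \<in> mor D N W" "s \<bullet> g = s' \<bullet> g"
  shows "s = s'"
  using inj_onD[OF bij_betw_imp_inj_on[OF orthogonal_precomp_bij_betw[OF assms(1-3)]]] assms(4-6)
  by simp

lemma orthogonal_factor:
  assumes "dtri D M L N f g h" "shift_orthogonal D M W" "W \<in> Obj D" "q \<in> mor D L W"
  shows "\<exists>s \<in> mor D N W. s \<bullet> g = q"
proof -
  have "q \<in> (\<lambda>s. s \<bullet> g) ` mor D N W"
    unfolding bij_betw_imp_surj_on[OF orthogonal_precomp_bij_betw[OF assms(1-3)]] by (rule assms(4))
  thus ?thesis by auto
qed

text \<open>\<open>L \<rightarrow> N\<close> is universal among the morphisms from \<open>L\<close> to objects right orthogonal to \<open>M\<close>, as is
  \<open>L \<rightarrow> N'\<close> with respect to \<open>M'\<close>; two universal morphisms differ by an isomorphism.\<close>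

lemma quotient_unique:
  assumes T: "dtri D M L N f g h" and T': "dtri D M' L N' f' g' h'"
    and o: "shift_orthogonal D M N" "shift_orthogonal D M N'"
      "shift_orthogonal D M' N" "shift_orthogonal D M' N'"
  shows "\<exists>a. isomorphism D N N' a \<and> a \<bullet> g = g'"
proof -
  have t: "L \<in> Obj D" "N \<in> Obj D" "N' \<in> Obj D" "g \<in> mor D L N" "g' \<in> mor D L N'"
    using tri_typed[OF T] tri_typed[OF T'] by simp_all
  obtain a where a: "a \<in> mor D N N'" "a \<bullet> g = g'"
    using orthogonal_factor[OF T o(2) t(3,5)] by blast
  obtain b where b: "b \<in> mor D N' N" "b \<bullet> g' = g"
    using orthogonal_factor[OF T' o(3) t(2,4)] by blast
  have "(b \<bullet> a) \<bullet> g = idm D N \<bullet> g"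
    using cmp_assoc[OF t(1,2,3,2,4) a(1) b(1)] a(2) b(2) id_left[OF t(1,2,4)] by simp
  hence ba: "b \<bullet> a = idm D N"
    by (rule orthogonal_epi[OF T o(1) t(2) cmp_mor[OF t(2,3,2) a(1) b(1)] id_mor[OF t(2)]])
  have "(a \<bullet> b) \<bullet> g' = idm D N' \<bullet> g'"
    using cmp_assoc[OF t(1,3,2,3,5) b(1) a(1)] a(2) b(2) id_left[OF t(1,3,5)] by simp
  hence ab: "a \<bullet> b = idm D N'"
    by (rule orthogonal_epi[OF T' o(4) t(3) cmp_mor[OF t(3,2,3) b(1) a(1)] id_mor[OF t(3)]])
  show ?thesis unfolding isomorphism_def using a b ba ab by blast
qed

text \<open>The difference \<open>x - id\<close> is killed by \<open>F\<close>, so it factors through \<open>N\<close>, and there is no nonzero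
  morphism from \<open>S\<close> to \<open>N\<close>. It is applied to a rotated triangle, with \<open>S\<close> the shift \<open>M[1]\<close> of the
  first object: fill-ins between triangles with common \<open>L\<close> and isomorphic \<open>N\<close> are then mutually inverse.\<close>

lemma orthogonal_endomorphism_eq_id:
  assumes T: "dtri D N S L h F k" and 0: "mor D S N = {zero_mor D S N}"
    and x: "x \<in> mor D S S" "F \<bullet> x = F"
  shows "x = idm D S"
proof -
  have t: "N \<in> Obj D" "S \<in> Obj D" "L \<in> Obj D" "h \<in> mor D N S" "F \<in> mor D S L"
    using tri_typed[OF T] by simp_all
  interpret SS: abelian_group "Hom D S S" by (rule hom_abelian_group[OF t(2,2)])
  interpret SL: abelian_group "Hom D S L" by (rule hom_abelian_group[OF t(2,3)])
  have i: "idm D S \<in> mor D S S" by (rule id_mor[OF t(2)])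
  have d: "x \<ominus>\<^bsub>Hom D S S\<^esub> idm D S \<in> mor D S S" by (rule SS.minus_closed[OF x(1) i])
  have "F \<bullet> (x \<ominus>\<^bsub>Hom D S S\<^esub> idm D S) = F \<ominus>\<^bsub>Hom D S L\<^esub> F"
    using cmp_diff_right[OF t(2,2,3) x(1) i t(5)] x(2) id_right[OF t(2,3,5)] by simp
  also have "\<dots> = zero_mor D S L" using SL.r_neg[OF t(5)] unfolding a_minus_def .
  finally obtain s where s: "s \<in> mor D S N" "h \<bullet> s = x \<ominus>\<^bsub>Hom D S S\<^esub> idm D S"
    using triangle_weak_kernel[OF T t(2) d] by blast
  from s(1) have "s = zero_mor D S N" unfolding 0 by (rule singletonD)
  hence "x \<ominus>\<^bsub>Hom D S S\<^esub> idm D S = zero_mor D S S" using s(2) cmp_zero_right[OF t(2,1,2,4)] by simp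
  hence "\<ominus>\<^bsub>Hom D S S\<^esub> (\<ominus>\<^bsub>Hom D S S\<^esub> idm D S) = x"
    using SS.minus_equality[of x "\<ominus>\<^bsub>Hom D S S\<^esub> idm D S"] x(1) i unfolding a_minus_def by simp
  thus ?thesis using SS.minus_minus[OF i] by simp
qed

lemma subobject_unique:
  assumes T: "dtri D M L N f g h" and T': "dtri D M' L N' f' g' h'"
    and o: "shift_orthogonal D M N" "shift_orthogonal D M N'"
      "shift_orthogonal D M' N" "shift_orthogonal D M' N'"
  shows "iso_obj D M M'"
proof -
  define F where "F = \<ominus>\<^bsub>Hom D (shO D M) (shO D L)\<^esub> shM D f"
  define F' where "F' = \<ominus>\<^bsub>Hom D (shO D M') (shO D L)\<^esub> shM D f'"
  have R: "dtri D L N (shO D M) g h F" and R': "dtri D L N' (shO D M') g' h' F'"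
    unfolding F_def F'_def using triangle_rotate T T' by blast+
  have t: "L \<in> Obj D" "N \<in> Obj D" "N' \<in> Obj D" "g \<in> mor D L N" "g' \<in> mor D L N'"
    "M \<in> Obj D" "M' \<in> Obj D" "shO D M \<in> Obj D" "shO D M' \<in> Obj D" "shO D L \<in> Obj D"
    "F \<in> mor D (shO D M) (shO D L)" "F' \<in> mor D (shO D M') (shO D L)"
    using tri_typed[OF T] tri_typed[OF T'] tri_typed[OF R] tri_typed[OF R'] sh_obj by simp_all
  \<comment> \<open>A fill-in over the identity of \<open>L\<close>; \<open>F1\<close> and \<open>F2\<close> are the connecting morphisms to \<open>L[1]\<close>.\<close>
  have comparison: "\<exists>m. m \<in> mor D (shO D A) (shO D B) \<and> F2 \<bullet> m = F1"
    if "dtri D L P (shO D A) g1 h1 F1" "dtri D L Q (shO D B) g2 h2 F2" "a \<in> mor D P Q" "a \<bullet> g1 = g2"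
    for A B P Q g1 g2 h1 h2 F1 F2 a
  proof -
    have "g2 \<in> mor D L Q" "F1 \<in> mor D (shO D A) (shO D L)" "Q \<in> Obj D" "shO D A \<in> Obj D"
      using tri_typed[OF that(1)] tri_typed[OF that(2)] by simp_all
    moreover from this have "a \<bullet> g1 = g2 \<bullet> idm D L" using id_right[of L Q g2] t that by simp
    ultimately show ?thesis
      using TR3[OF that(1,2) id_mor[OF t(1)] that(3)] id_left[of "shO D A" "shO D L" F1] t sh_id[OF t(1)]
      by auto
  qed
  obtain a where a: "isomorphism D N N' a" "a \<bullet> g = g'"
    using quotient_unique[OF T T' o] by blast
  obtain b where b: "isomorphism D N' N b" "b \<bullet> g' = g"
    using quotient_unique[OF T' T o(4,3,2,1)] by blast
  obtain m where m: "m \<in> mor D (shO D M) (shO D M')" "F' \<bullet> m = F"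
    using comparison[OF R R'] a unfolding isomorphism_def by blast
  obtain n where n: "n \<in> mor D (shO D M') (shO D M)" "F \<bullet> n = F'"
    using comparison[OF R' R] b unfolding isomorphism_def by blast
  have "F \<bullet> (n \<bullet> m) = F"
    using cmp_assoc[OF t(8,9,8,10) m(1) n(1) t(11)] m(2) n(2) by simp
  hence nm: "n \<bullet> m = idm D (shO D M)"
    by (rule orthogonal_endomorphism_eq_id[OF triangle_rotate[OF R] shift_orthogonalD(2)[OF o(1)]
        cmp_mor[OF t(8,9,8) m(1) n(1)]])
  have "F' \<bullet> (m \<bullet> n) = F'"
    using cmp_assoc[OF t(9,8,9,10) n(1) m(1) t(12)] m(2) n(2) by simp
  hence mn: "m \<bullet> n = idm D (shO D M')"
    by (rule orthogonal_endomorphism_eq_id[OF triangle_rotate[OF R'] shift_orthogonalD(2)[OF o(4)]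
        cmp_mor[OF t(9,8,9) n(1) m(1)]])
  have "iso_obj D (shO D M) (shO D M')"
    unfolding iso_obj_def isomorphism_def using t m n nm mn by blast
  thus ?thesis by (rule iso_obj_unshift[OF t(6,7)])
qed

end

section \<open>Hall numbers of orthogonal pairs\<close>

context triangulated_category
begin

text \<open>Replacing the cone by the isomorphic \<open>M[1]\<close> gives a triangle \<open>L \<rightarrow> N \<rightarrow> M[1] \<rightarrow> L[1]\<close>, whose last
  morphism is a shift because the shift functor is full; so it can be rotated back.\<close>

lemma mor_with_cone_shift_iff:
  assumes M: "M \<in> Obj D" and L: "L \<in> Obj D" and N: "N \<in> Obj D"
  shows "g \<in> mor_with_cone D L N (shO D M) \<longleftrightarrow> (\<exists>f h. dtri D M L N f g h)"
proof
  assume "\<exists>f h. dtri D M L N f g h"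
  then obtain f h where T: "dtri D M L N f g h" by blast
  thus "g \<in> mor_with_cone D L N (shO D M)"
    unfolding mor_with_cone_def
    using triangle_rotate[OF T] tri_typed[OF T] iso_obj_refl[OF sh_obj[OF M]] by blast
next
  assume "g \<in> mor_with_cone D L N (shO D M)"
  then obtain C a b where T: "dtri D L N C g a b" and C: "iso_obj D C (shO D M)"
    unfolding mor_with_cone_def by blast
  obtain c d where cd: "c \<in> mor D C (shO D M)" "d \<in> mor D (shO D M) C"
    "d \<bullet> c = idm D C" "isomorphism D C (shO D M) c"
    using C unfolding iso_obj_def isomorphism_def by blast
  have t: "C \<in> Obj D" "g \<in> mor D L N" "a \<in> mor D N C" "b \<in> mor D C (shO D L)"
    using tri_typed[OF T] by simp_all
  have s: "shO D M \<in> Obj D" "shO D L \<in> Obj D" using sh_obj M L by blast+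
  have ca: "c \<bullet> a \<in> mor D N (shO D M)" by (rule cmp_mor[OF N t(1) s(1) t(3) cd(1)])
  have bd: "b \<bullet> d \<in> mor D (shO D M) (shO D L)" by (rule cmp_mor[OF s(1) t(1) s(2) cd(2) t(4)])
  have "idm D N \<bullet> g = g \<bullet> idm D L" using id_left[OF L N t(2)] id_right[OF L N t(2)] by simp
  moreover have "c \<bullet> a = (c \<bullet> a) \<bullet> idm D N" using id_right[OF N s(1) ca] by simp
  moreover have "shM D (idm D L) \<bullet> b = (b \<bullet> d) \<bullet> c"
    using cmp_assoc[OF t(1) s(1) t(1) s(2) cd(1,2) t(4)] cd(3) id_right[OF t(1) s(2) t(4)]
      id_left[OF t(1) s(2) t(4)] sh_id[OF L] by simp
  ultimately have T2: "dtri D L N (shO D M) g (c \<bullet> a) (b \<bullet> d)"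
    using TR1_iso[OF T L N s(1) t(2) ca bd isomorphism_id[OF L] isomorphism_id[OF N] cd(4)] by blast
  interpret S: abelian_group "Hom D (shO D M) (shO D L)" by (rule hom_abelian_group[OF s])
  have "shM D ` mor D M L = mor D (shO D M) (shO D L)"
    using sh_fully_faithful[OF M L] by (rule bij_betw_imp_surj_on)
  then obtain e where e: "e \<in> mor D M L"
    "shM D e = \<ominus>\<^bsub>Hom D (shO D M) (shO D L)\<^esub> (b \<bullet> d)"
    using S.a_inv_closed[OF bd] by (metis imageE)
  have "dtri D M L N e g (c \<bullet> a)"
    using TR2[OF M L N e(1) t(2) ca] e(2) S.minus_minus[OF bd] T2 by simp
  thus "\<exists>f h. dtri D M L N f g h" by blast
qed

text \<open>Composing \<open>g\<close> with an automorphism of \<open>N\<close> gives an isomorphic triangle, and conversely any two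
  triangles on \<open>M\<close>, \<open>L\<close>, \<open>N\<close> differ by such an automorphism, by uniqueness of the quotient.\<close>

lemma automorphisms_bij_mor_with_cone:
  assumes T: "dtri D M L N f g h" and o: "shift_orthogonal D M N"
  shows "bij_betw (\<lambda>a. a \<bullet> g) (Units (End_ring D N)) (mor_with_cone D L N (shO D M))"
proof (rule bij_betw_imageI)
  have t: "M \<in> Obj D" "L \<in> Obj D" "N \<in> Obj D" "f \<in> mor D M L" "g \<in> mor D L N" "h \<in> mor D N (shO D M)"
    "shO D M \<in> Obj D"
    using tri_typed[OF T] sh_obj by simp_all
  show "inj_on (\<lambda>a. a \<bullet> g) (Units (End_ring D N))"
    by (rule inj_onI, rule orthogonal_epi[OF T o t(3)])
      (simp_all add: Units_End_ring_iff isomorphism_def)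
  show "(\<lambda>a. a \<bullet> g) ` Units (End_ring D N) = mor_with_cone D L N (shO D M)"
  proof (intro equalityI subsetI)
    fix q assume "q \<in> (\<lambda>a. a \<bullet> g) ` Units (End_ring D N)"
    then obtain a where q: "q = a \<bullet> g" and iso: "isomorphism D N N a"
      by (auto simp: Units_End_ring_iff)
    obtain b where a: "a \<in> mor D N N" and b: "b \<in> mor D N N" "b \<bullet> a = idm D N"
      using iso unfolding isomorphism_def by blast
    have ag: "a \<bullet> g \<in> mor D L N" by (rule cmp_mor[OF t(2,3,3,5) a])
    have hb: "h \<bullet> b \<in> mor D N (shO D M)" by (rule cmp_mor[OF t(3,3,7) b(1) t(6)])
    have "idm D L \<bullet> f = f \<bullet> idm D M" using id_left[OF t(1,2,4)] id_right[OF t(1,2,4)] by simp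
    moreover have "a \<bullet> g = (a \<bullet> g) \<bullet> idm D L" using id_right[OF t(2,3) ag] by simp
    moreover have "shM D (idm D M) \<bullet> h = (h \<bullet> b) \<bullet> a"
      using cmp_assoc[OF t(3,3,3,7) a b(1) t(6)] b(2) id_right[OF t(3,7,6)] id_left[OF t(3,7,6)]
        sh_id[OF t(1)] by simp
    ultimately have "dtri D M L N f (a \<bullet> g) (h \<bullet> b)"
      using TR1_iso[OF T t(1,2,3,4) ag hb isomorphism_id[OF t(1)] isomorphism_id[OF t(2)] iso] by blast
    thus "q \<in> mor_with_cone D L N (shO D M)"
      unfolding q mor_with_cone_shift_iff[OF t(1-3)] by blast
  next
    fix q assume "q \<in> mor_with_cone D L N (shO D M)"
    then obtain f' h' where "dtri D M L N f' q h'"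
      unfolding mor_with_cone_shift_iff[OF t(1-3)] by blast
    then obtain a where "a \<in> Units (End_ring D N)" "a \<bullet> g = q"
      using quotient_unique[OF T _ o o o o] unfolding Units_End_ring_iff by blast
    thus "q \<in> (\<lambda>a. a \<bullet> g) ` Units (End_ring D N)" by auto
  qed
qed

lemma shift_orthogonal_funpow: 
  assumes "shift_orthogonal D M N" shows "shift_orthogonal D ((shO D ^^ i) M) N"
  unfolding shift_orthogonal_def
proof
  fix j
  have "(shO D ^^ j) ((shO D ^^ i) M) = (shO D ^^ (j + i)) M" by (simp add: funpow_add)
  thus "mor D ((shO D ^^ j) ((shO D ^^ i) M)) N = {zero_mor D ((shO D ^^ j) ((shO D ^^ i) M)) N}"
    using assms unfolding shift_orthogonal_def by simp
qed

lemma hom_pairing_eq: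
  assumes T: "dtri D M L N f g h" and o: "shift_orthogonal D M W" and W: "W \<in> Obj D"
  shows "hom_pairing D L W = hom_pairing D N W"
proof -
  have "card (mor D ((shO D ^^ i) L) W) = card (mor D ((shO D ^^ i) N) W)" for i
  proof -
    obtain f' g' h' where "dtri D ((shO D ^^ i) M) ((shO D ^^ i) L) ((shO D ^^ i) N) f' g' h'"
      using triangle_funpow_shift[OF T] by blast
    from bij_betw_same_card[OF orthogonal_precomp_bij_betw[OF this shift_orthogonal_funpow[OF o] W]]
    show ?thesis by simp
  qed
  thus ?thesis unfolding hom_pairing_def by simp
qed

text \<open>If infinitely many factors differ from 1, the product is 1 by convention, so only the finite
  case needs an argument; there every factor is a power of the size of a finite nonempty set.\<close>

lemma hom_pairing_nonzero:
  assumes fin: "\<And>i. finite (mor D ((shO D ^^ i) L) N)" and "L \<in> Obj D" "N \<in> Obj D"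
  shows "hom_pairing D L N \<noteq> 0"
proof -
  have "mor D ((shO D ^^ i) L) N \<noteq> {}" for i
    using zero_mor_closed[OF funpow_shift_obj assms(3)] assms(2) by blast
  hence "card (mor D ((shO D ^^ i) L) N) \<noteq> 0" for i using fin by simp
  thus ?thesis unfolding hom_pairing_def prod.G_def by (auto simp: power_int_eq_0_iff prod_zero_iff)
qed

lemma hall_number_orthogonal:
  assumes T: "dtri D M L N f g h" and o: "shift_orthogonal D M N"
    and fin: "\<And>i. finite (mor D ((shO D ^^ i) N) N)"
  shows "hall_number D M N L = 1"
proof -
  have N: "N \<in> Obj D" using tri_typed[OF T] by simp
  have "card (Units (End_ring D N)) = card (mor_with_cone D L N (shO D M))"
    by (rule bij_betw_same_card[OF automorphisms_bij_mor_with_cone[OF T o]])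
  moreover have "finite (Units (End_ring D N))"
    by (rule finite_subset[OF _ fin[of 0]]) (auto simp: Units_End_ring_iff isomorphism_def)
  moreover have "idm D N \<in> Units (End_ring D N)"
    unfolding Units_End_ring_iff by (rule isomorphism_id[OF N])
  moreover from calculation have "card (Units (End_ring D N)) \<noteq> 0" using card_0_eq by blast
  ultimately show ?thesis
    unfolding hall_number_def hom_pairing_eq[OF T o N]
    using hom_pairing_nonzero[OF fin N N] by simp
qed

lemma hall_number_nonzeroD:
  assumes "hall_number D M N L \<noteq> 0" "M \<in> Obj D" "L \<in> Obj D" "N \<in> Obj D"
  shows "\<exists>f g h. dtri D M L N f g h"
proof -
  have "card (mor_with_cone D L N (shO D M)) \<noteq> 0" using assms(1) unfolding hall_number_def by auto
  hence "mor_with_cone D L N (shO D M) \<noteq> {}" by auto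
  thus ?thesis using mor_with_cone_shift_iff[OF assms(2-4)] by blast
qed

end

section \<open>Harder-Narasimhan types\<close>

text \<open>The phases of a filtration whose factors are nonzero and semistable, from the first step to the last. That
  they descend is a separate condition on the list, so that the last factor can be split off.\<close>

inductive HN_type :: "('k, 'o, 'm, 'z) tricat_scheme \<Rightarrow> (real \<Rightarrow> 'o set) \<Rightarrow> real list \<Rightarrow> 'o \<Rightarrow> bool"
  for D :: "('k, 'o, 'm, 'z) tricat_scheme" and P :: "real \<Rightarrow> 'o set"
  where
    zero: "zero_object D X \<Longrightarrow> HN_type D P [] X"
  | extend: "\<lbrakk>HN_type D P \<phi>s M; dtri D M X A u v w; A \<in> P \<phi>; \<not> zero_object D A\<rbrakk>
      \<Longrightarrow> HN_type D P (\<phi>s @ [\<phi>]) X"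

lemma HN_type_Nil_iff: "HN_type D P [] X \<longleftrightarrow> zero_object D X"
  by (auto elim: HN_type.cases intro: HN_type.zero)

lemma HN_type_snoc_iff:
  "HN_type D P (\<phi>s @ [\<phi>]) X \<longleftrightarrow>
    (\<exists>M A u v w. HN_type D P \<phi>s M \<and> dtri D M X A u v w \<and> A \<in> P \<phi> \<and> \<not> zero_object D A)"
proof
  assume "HN_type D P (\<phi>s @ [\<phi>]) X"
  thus "\<exists>M A u v w. HN_type D P \<phi>s M \<and> dtri D M X A u v w \<and> A \<in> P \<phi> \<and> \<not> zero_object D A"
    by (cases rule: HN_type.cases) (simp, blast)
qed (blast intro: HN_type.extend)

lemma has_HN_filtration_imp_HN_type:
  assumes "has_HN_filtration D P X"
  shows "\<exists>\<phi>s. sorted_wrt (>) \<phi>s \<and> HN_type D P \<phi>s X"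
proof -
  obtain n :: nat and M A \<phi> u v w where z: "zero_object D (M 0)" and X: "M n = X"
    and tri: "\<And>i. i \<in> {1..n} \<Longrightarrow> dtri D (M (i - 1)) (M i) (A i) (u i) (v i) (w i) \<and>
        A i \<in> P (\<phi> i) \<and> \<not> zero_object D (A i)"
    and desc: "\<And>i j. \<lbrakk>1 \<le> i; i < j; j \<le> n\<rbrakk> \<Longrightarrow> \<phi> i > (\<phi> j :: real)"
    using assms unfolding has_HN_filtration_def by (elim exE conjE) blast
  have "i \<le> n \<Longrightarrow> sorted_wrt (>) (map \<phi> [1..<Suc i]) \<and> HN_type D P (map \<phi> [1..<Suc i]) (M i)" for i
  proof (induction i)
    case 0
    show ?case using z by (simp add: HN_type_Nil_iff)
  next
    case (Suc i)
    have IH: "sorted_wrt (>) (map \<phi> [1..<Suc i])" "HN_type D P (map \<phi> [1..<Suc i]) (M i)"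
      using Suc by simp_all
    have "dtri D (M i) (M (Suc i)) (A (Suc i)) (u (Suc i)) (v (Suc i)) (w (Suc i))"
      "A (Suc i) \<in> P (\<phi> (Suc i))" "\<not> zero_object D (A (Suc i))"
      using tri[of "Suc i"] Suc.prems by simp_all
    hence "HN_type D P (map \<phi> [1..<Suc i] @ [\<phi> (Suc i)]) (M (Suc i))"
      by (rule HN_type.extend[OF IH(2)])
    moreover have "sorted_wrt (>) (map \<phi> [1..<Suc i] @ [\<phi> (Suc i)])"
      using IH(1) Suc.prems desc by (auto simp: sorted_wrt_append simp del: upt_Suc)
    ultimately show ?case by simp
  qed
  from this[of n] show ?thesis using X by auto
qed

context triangulated_category
begin

lemma triangle_iso_obj:
  assumes T: "dtri D X Y Z f g h" and "iso_obj D X X'" "iso_obj D Y Y'" "iso_obj D Z Z'"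
  shows "\<exists>f' g' h'. dtri D X' Y' Z' f' g' h'"
proof -
  obtain \<alpha> \<alpha>' where a: "isomorphism D X X' \<alpha>" "\<alpha> \<in> mor D X X'" "\<alpha>' \<in> mor D X' X" "\<alpha>' \<bullet> \<alpha> = idm D X"
    using assms(2) unfolding iso_obj_def isomorphism_def by blast
  obtain \<beta> \<beta>' where b: "isomorphism D Y Y' \<beta>" "\<beta> \<in> mor D Y Y'" "\<beta>' \<in> mor D Y' Y" "\<beta>' \<bullet> \<beta> = idm D Y"
    using assms(3) unfolding iso_obj_def isomorphism_def by blast
  obtain \<gamma> \<gamma>' where c: "isomorphism D Z Z' \<gamma>" "\<gamma> \<in> mor D Z Z'" "\<gamma>' \<in> mor D Z' Z" "\<gamma>' \<bullet> \<gamma> = idm D Z"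
    using assms(4) unfolding iso_obj_def isomorphism_def by blast
  have o: "X \<in> Obj D" "Y \<in> Obj D" "Z \<in> Obj D" "X' \<in> Obj D" "Y' \<in> Obj D" "Z' \<in> Obj D"
    using assms(2-4) unfolding iso_obj_def by blast+
  have s: "shO D X \<in> Obj D" "shO D X' \<in> Obj D" using o sh_obj by blast+
  have t: "f \<in> mor D X Y" "g \<in> mor D Y Z" "h \<in> mor D Z (shO D X)" using tri_typed[OF T] by simp_all
  have sa: "shM D \<alpha> \<in> mor D (shO D X) (shO D X')" by (rule sh_mor[OF o(1,4) a(2)])
  have bf: "\<beta> \<bullet> f \<in> mor D X Y'" by (rule cmp_mor[OF o(1,2,5) t(1) b(2)])
  have cg: "\<gamma> \<bullet> g \<in> mor D Y Z'" by (rule cmp_mor[OF o(2,3,6) t(2) c(2)])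
  have ah: "shM D \<alpha> \<bullet> h \<in> mor D Z (shO D X')" by (rule cmp_mor[OF o(3) s t(3) sa])
  have "\<beta> \<bullet> f = ((\<beta> \<bullet> f) \<bullet> \<alpha>') \<bullet> \<alpha>"
    using cmp_assoc[OF o(1,4,1,5) a(2,3) bf] a(4) id_right[OF o(1,5) bf] by simp
  moreover have "\<gamma> \<bullet> g = ((\<gamma> \<bullet> g) \<bullet> \<beta>') \<bullet> \<beta>"
    using cmp_assoc[OF o(2,5,2,6) b(2,3) cg] b(4) id_right[OF o(2,6) cg] by simp
  moreover have "shM D \<alpha> \<bullet> h = ((shM D \<alpha> \<bullet> h) \<bullet> \<gamma>') \<bullet> \<gamma>"
    using cmp_assoc[OF o(3,6,3) s(2) c(2,3) ah] c(4) id_right[OF o(3) s(2) ah] by simp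
  ultimately have "dtri D X' Y' Z' ((\<beta> \<bullet> f) \<bullet> \<alpha>') ((\<gamma> \<bullet> g) \<bullet> \<beta>') ((shM D \<alpha> \<bullet> h) \<bullet> \<gamma>')"
    by (rule TR1_iso[OF T o(4-6) cmp_mor[OF o(4,1,5) a(3) bf] cmp_mor[OF o(5,2,6) b(3) cg]
        cmp_mor[OF o(6,3) s(2) c(3) ah] a(1) b(1) c(1)])
  thus ?thesis by blast
qed

lemma HN_type_iso_obj:
  assumes "HN_type D P \<phi>s X" "iso_obj D X Y" shows "HN_type D P \<phi>s Y"
  using assms(1)
proof (cases rule: HN_type.cases)
  case zero
  thus ?thesis using zero_object_iso_obj[OF _ assms(2)] by (simp add: HN_type_Nil_iff)
next
  case (extend \<psi>s M A u v w \<psi>)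
  have "M \<in> Obj D" "A \<in> Obj D" using tri_typed[OF extend(3)] by simp_all
  then obtain u' v' w' where T: "dtri D M Y A u' v' w'"
    using triangle_iso_obj[OF extend(3) iso_obj_refl assms(2) iso_obj_refl] by blast
  show ?thesis unfolding extend(1) by (rule HN_type.extend[OF extend(2) T extend(4,5)])
qed

lemma shift_orthogonal_zero_object:
  assumes "zero_object D M" "N \<in> Obj D" shows "shift_orthogonal D M N"
  unfolding shift_orthogonal_def
  by (intro allI mor_from_zero_object[OF funpow_shift_zero_object[OF assms(1)] assms(2)])

lemma shift_orthogonal_extension:
  assumes T: "dtri D M X A u v w" and "shift_orthogonal D M N" "shift_orthogonal D A N" and N: "N \<in> Obj D"
  shows "shift_orthogonal D X N"
  unfolding shift_orthogonal_def
proof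
  fix i
  let ?s = "\<lambda>Y. (shO D ^^ i) Y"
  obtain u' v' w' where T': "dtri D (?s M) (?s X) (?s A) u' v' w'"
    using triangle_funpow_shift[OF T] by blast
  have t: "?s M \<in> Obj D" "?s X \<in> Obj D" "?s A \<in> Obj D" "v' \<in> mor D (?s X) (?s A)"
    using tri_typed[OF T'] by simp_all
  have A: "mor D (?s A) N = {zero_mor D (?s A) N}"
    using assms(3) unfolding shift_orthogonal_def by blast
  have "q = zero_mor D (?s X) N" if q: "q \<in> mor D (?s X) N" for q
  proof -
    obtain s where s: "s \<in> mor D (?s A) N" "s \<bullet> v' = q"
      using orthogonal_factor[OF T' shift_orthogonal_funpow[OF assms(2), of i] N q] by blast
    from s(1) have "s = zero_mor D (?s A) N" unfolding A by (rule singletonD)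
    thus ?thesis using s(2) cmp_zero_left[OF t(2,3) N t(4)] by simp
  qed
  thus "mor D (?s X) N = {zero_mor D (?s X) N}" using zero_mor_closed[OF t(2) N] by blast
qed

text \<open>If \<open>v\<close> were zero, then \<open>id\<close> and \<open>0\<close> on \<open>A\<close> would agree after composition with \<open>v\<close>, hence be equal.\<close>

lemma nonzero_quotient:
  assumes T: "dtri D M X A u v w" and o: "shift_orthogonal D M A" and A: "\<not> zero_object D A"
  shows "mor D X A \<noteq> {zero_mor D X A}"
proof
  assume 0: "mor D X A = {zero_mor D X A}"
  have t: "X \<in> Obj D" "A \<in> Obj D" "v \<in> mor D X A" using tri_typed[OF T] by simp_all
  from t(3) have "v = zero_mor D X A" unfolding 0 by (rule singletonD)
  hence "idm D A \<bullet> v = zero_mor D A A \<bullet> v"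
    using id_left[OF t] cmp_zero_left[OF t(1,2,2,3)] by simp
  hence "idm D A = zero_mor D A A"
    by (rule orthogonal_epi[OF T o t(2) id_mor[OF t(2)] zero_mor_closed[OF t(2,2)]])
  thus False using A zero_object_iff_id_eq_zero[OF t(2)] by simp
qed

end

locale finite_stable_category = triangulated_category K D
  for K :: "('k, 'r) ring_scheme" and D :: "('k, 'o, 'm, 'z) tricat_scheme" (structure) +
  fixes Zc :: "('o \<Rightarrow>\<^sub>0 int) set \<Rightarrow> complex" and P :: "real \<Rightarrow> 'o set"
  assumes finite_field: "finite (carrier K)"
    and left_hom_finite: "left_homologically_finite K D"
    and stable: "stability_condition D (Zc, P)"
begin

lemma finite_shifted_mor:
  assumes "X \<in> Obj D" "Y \<in> Obj D" shows "finite (mor D ((shO D ^^ i) X) Y)"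
  using finite_mor[OF finite_field funpow_shift_obj[OF assms(1)] assms(2)] left_hom_finite assms
  unfolding left_homologically_finite_def by blast

lemma P_subcategory_all: "\<forall>\<phi>. additive_subcategory D (P \<phi>) \<and> extension_closed D (P \<phi>)"
  using stable unfolding stability_condition_def prod.case by (elim conjE)

lemma P_shift_eq: "\<forall>\<phi>. P (\<phi> + 1) = {Y. \<exists>X \<in> P \<phi>. iso_obj D (shO D X) Y}"
  using stable unfolding stability_condition_def prod.case by (elim conjE)

lemma P_hom_vanishing:
  "\<forall>\<phi> \<psi>. \<phi> > \<psi> \<longrightarrow> (\<forall>X \<in> P \<phi>. \<forall>Y \<in> P \<psi>. mor D X Y = {zero_mor D X Y})"
  using stable unfolding stability_condition_def prod.case by (elim conjE)

lemma HN_filtration_exists: "\<forall>X \<in> Obj D. \<not> zero_object D X \<longrightarrow> has_HN_filtration D P X"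
  using stable unfolding stability_condition_def prod.case by (elim conjE)

lemma P_subcategory: "additive_subcategory D (P \<phi>)" "extension_closed D (P \<phi>)"
  using P_subcategory_all by blast+

lemma P_Obj: "X \<in> P \<phi> \<Longrightarrow> X \<in> Obj D"
  using P_subcategory(1) unfolding additive_subcategory_def by blast

lemma P_extension: "\<lbrakk>dtri D X Y Z f g h; X \<in> P \<phi>; Z \<in> P \<phi>\<rbrakk> \<Longrightarrow> Y \<in> P \<phi>"
  using P_subcategory(2) unfolding extension_closed_def by blast

text \<open>An object isomorphic to \<open>X\<close> is an extension of a zero object by \<open>X\<close>.\<close>

lemma P_iso_obj:
  assumes "X \<in> P \<phi>" "iso_obj D X Y" shows "Y \<in> P \<phi>"
proof -
  obtain N where N: "N \<in> P \<phi>" "zero_object D N"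
    using P_subcategory(1) unfolding additive_subcategory_def by blast
  obtain f g h where "dtri D X Y N f g h"
    using triangle_iso_obj[OF TR1_id[OF P_Obj[OF assms(1)] N(2)] iso_obj_refl[OF P_Obj[OF assms(1)]]
        assms(2) iso_obj_refl[OF P_Obj[OF N(1)]]] by blast
  thus ?thesis using P_extension assms(1) N(1) by blast
qed

lemma P_zero_object:
  assumes "zero_object D N" shows "N \<in> P \<phi>"
proof -
  obtain N' where "N' \<in> P \<phi>" "zero_object D N'"
    using P_subcategory(1) unfolding additive_subcategory_def by blast
  thus ?thesis using P_iso_obj iso_obj_zero_object assms by blast
qed

lemma P_shift:
  assumes "X \<in> P \<phi>" shows "(shO D ^^ i) X \<in> P (\<phi> + real i)"
proof (induction i)
  case 0
  show ?case using assms by simp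
next
  case (Suc i)
  have "P (\<phi> + real i + 1) = {Y. \<exists>X \<in> P (\<phi> + real i). iso_obj D (shO D X) Y}"
    using P_shift_eq by blast
  moreover have "iso_obj D (shO D ((shO D ^^ i) X)) (shO D ((shO D ^^ i) X))"
    using iso_obj_refl sh_obj P_Obj[OF Suc] by blast
  ultimately have "shO D ((shO D ^^ i) X) \<in> P (\<phi> + real i + 1)" using Suc by blast
  thus ?case by (simp add: add.commute add.left_commute)
qed

lemma P_orthogonal:
  assumes "X \<in> P \<phi>" "Y \<in> P \<psi>" "\<psi> < \<phi>" shows "shift_orthogonal D X Y"
proof -
  have "\<psi> < \<phi> + real i" for i using assms(3) by simp
  thus ?thesis
    unfolding shift_orthogonal_def using P_hom_vanishing P_shift[OF assms(1)] assms(2) by blast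
qed

lemma HN_type_orthogonal:
  assumes "HN_type D P \<phi>s X" "\<forall>\<phi> \<in> set \<phi>s. \<psi> < \<phi>" "N \<in> P \<psi>"
  shows "shift_orthogonal D X N"
  using assms(1,2)
proof (induction rule: HN_type.induct)
  case (zero X)
  thus ?case using shift_orthogonal_zero_object P_Obj[OF assms(3)] by blast
next
  case (extend \<phi>s M X A u v w \<phi>)
  have "shift_orthogonal D A N" using P_orthogonal[OF extend.hyps(3) assms(3)] extend.prems by simp
  thus ?case using shift_orthogonal_extension[OF extend.hyps(2)] extend P_Obj[OF assms(3)] by simp
qed

text \<open>If all of \<open>\<phi>s\<close> exceeded \<open>\<psi>\<close>, then \<open>X\<close> would be orthogonal to the last factor of its other
  filtration, although the projection to this factor is nonzero. For \<open>\<phi>s = []\<close> the lemma excludes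
  that a zero object has a nonempty descending type.\<close>

lemma HN_type_last_phase:
  assumes "HN_type D P \<phi>s X" "HN_type D P (\<psi>s @ [\<psi>]) X" "\<forall>\<chi> \<in> set \<psi>s. \<psi> < \<chi>"
  shows "\<not> (\<forall>\<phi> \<in> set \<phi>s. \<psi> < \<phi>)"
proof
  assume less: "\<forall>\<phi> \<in> set \<phi>s. \<psi> < \<phi>"
  obtain M A u v w where HN: "HN_type D P \<psi>s M" "dtri D M X A u v w" "A \<in> P \<psi>" "\<not> zero_object D A"
    using assms(2) unfolding HN_type_snoc_iff by blast
  have "mor D X A \<noteq> {zero_mor D X A}"
    by (rule nonzero_quotient[OF HN(2) HN_type_orthogonal[OF HN(1) assms(3) HN(3)] HN(4)])
  thus False using shift_orthogonalD(1)[OF HN_type_orthogonal[OF assms(1) less HN(3)]] by blast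
qed

text \<open>By the preceding lemma, used in both directions, the last phases agree. Then the two penultimate
  steps of the filtrations are isomorphic by \<open>subobject_unique\<close>, and induction applies to them.\<close>

lemma HN_type_unique:
  assumes "HN_type D P \<phi>s X" "HN_type D P \<psi>s X" "sorted_wrt (>) \<phi>s" "sorted_wrt (>) \<psi>s"
  shows "\<phi>s = \<psi>s"
  using assms
proof (induction \<phi>s arbitrary: X \<psi>s rule: rev_induct)
  case Nil
  show ?case
  proof (cases \<psi>s rule: rev_cases)
    case (snoc b \<psi>)
    thus ?thesis using HN_type_last_phase[of "[]" X b \<psi>] Nil by (auto simp: sorted_wrt_append)
  qed simp
next
  case (snoc \<phi> a)
  have a: "\<forall>\<chi> \<in> set a. \<phi> < \<chi>" "sorted_wrt (>) a" using snoc.prems(3) by (auto simp: sorted_wrt_append)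
  show ?case
  proof (cases \<psi>s rule: rev_cases)
    case Nil
    thus ?thesis using HN_type_last_phase[of "[]" X a \<phi>] snoc.prems a by auto
  next
    case psi: (snoc b \<psi>)
    have b: "\<forall>\<chi> \<in> set b. \<psi> < \<chi>" "sorted_wrt (>) b" "HN_type D P (b @ [\<psi>]) X"
      using snoc.prems(2,4) unfolding psi by (auto simp: sorted_wrt_append)
    have "\<not> \<psi> < \<phi>" using HN_type_last_phase[OF snoc.prems(1) b(3,1)] a(1) by auto
    moreover have "\<not> \<phi> < \<psi>" using HN_type_last_phase[OF b(3) snoc.prems(1) a(1)] b(1) by auto
    ultimately have eq: "\<psi> = \<phi>" by simp
    obtain M A u v w where M: "HN_type D P a M" "dtri D M X A u v w" "A \<in> P \<phi>"
      using snoc.prems(1) unfolding HN_type_snoc_iff by blast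
    obtain M' A' u' v' w' where M': "HN_type D P b M'" "dtri D M' X A' u' v' w'" "A' \<in> P \<phi>"
      using b(3) unfolding HN_type_snoc_iff eq by blast
    note b1 = b(1)[unfolded eq]
    have "iso_obj D M' M"
      by (rule subobject_unique[OF M'(2) M(2)
            HN_type_orthogonal[OF M'(1) b1 M'(3)] HN_type_orthogonal[OF M'(1) b1 M(3)]
            HN_type_orthogonal[OF M(1) a(1) M'(3)] HN_type_orthogonal[OF M(1) a(1) M(3)]])
    hence "HN_type D P b M" by (rule HN_type_iso_obj[OF M'(1)])
    thus ?thesis using snoc.IH[OF M(1) _ a(2) b(2)] eq psi by simp
  qed
qed

lemma HN_type_exists:
  assumes "X \<in> Obj D" shows "\<exists>\<phi>s. sorted_wrt (>) \<phi>s \<and> HN_type D P \<phi>s X"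
proof (cases "zero_object D X")
  case True
  thus ?thesis using HN_type.zero[of D X P] sorted_wrt.simps(1) by blast
next
  case False
  hence "has_HN_filtration D P X" using HN_filtration_exists assms by blast
  thus ?thesis by (rule has_HN_filtration_imp_HN_type)
qed

lemma HN_type_singleton_iff: "HN_type D P [\<phi>] X \<longleftrightarrow> X \<in> P \<phi> \<and> \<not> zero_object D X"
proof
  assume "X \<in> P \<phi> \<and> \<not> zero_object D X"
  moreover obtain N where N: "zero_object D N" using zero_object_exists by blast
  ultimately show "HN_type D P [\<phi>] X"
    using HN_type.extend[OF HN_type.zero[OF N] triangle_zero_id[OF _ N]] P_Obj by fastforce
next
  assume "HN_type D P [\<phi>] X"
  then obtain M A u v w where M: "zero_object D M" "dtri D M X A u v w" "A \<in> P \<phi>" "\<not> zero_object D A"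
    using HN_type_snoc_iff[of D P "[]" \<phi> X] unfolding HN_type_Nil_iff by auto
  have "X \<in> P \<phi>" by (rule P_extension[OF M(2) P_zero_object[OF M(1)] M(3)])
  moreover have "\<not> zero_object D X"
    using nonzero_quotient[OF M(2) shift_orthogonal_zero_object[OF M(1) P_Obj[OF M(3)]] M(4)]
      mor_from_zero_object P_Obj[OF M(3)] by blast
  ultimately show "X \<in> P \<phi> \<and> \<not> zero_object D X" by blast
qed

end

section \<open>Products in the derived Hall algebra\<close>

lemma hall_prod_snoc: "fs \<noteq> [] \<Longrightarrow> hall_prod D (fs @ [f]) = hall_mult D (hall_prod D fs) f"
  by (cases fs) (simp_all add: hall_prod_def)

context finite_stable_category
begin

lemma hall_unit_eq:
  assumes "C \<in> iso_classes D" shows "hall_unit D C = of_bool (zero_object D (rep C))"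
proof -
  note C = rep_iso_class[OF assms]
  have "(\<exists>X. zero_object D X \<and> C = iso_class D X) \<longleftrightarrow> zero_object D (rep C)"
  proof
    assume "\<exists>X. zero_object D X \<and> C = iso_class D X"
    then obtain X where X: "zero_object D X" "C = iso_class D X" by blast
    hence "iso_obj D X (rep C)" using iso_class_eq_iff[of X "rep C"] zero_object_Obj C by simp
    thus "zero_object D (rep C)" by (rule zero_object_iso_obj[OF X(1)])
  next
    assume "zero_object D (rep C)"
    thus "\<exists>X. zero_object D X \<and> C = iso_class D X" using C(2) by auto
  qed
  thus ?thesis unfolding hall_unit_def by simp
qed

lemma SS_minus_unit_eq:
  assumes "C \<in> iso_classes D"
  shows "SS D (Zc, P) \<phi> C - hall_unit D C = of_bool (rep C \<in> P \<phi> \<and> \<not> zero_object D (rep C))"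
proof -
  note C = rep_iso_class[OF assms]
  have "(\<exists>X \<in> P \<phi>. C = iso_class D X) \<longleftrightarrow> rep C \<in> P \<phi>"
  proof
    assume "\<exists>X \<in> P \<phi>. C = iso_class D X"
    then obtain X where X: "X \<in> P \<phi>" "C = iso_class D X" by blast
    hence "iso_obj D X (rep C)" using iso_class_eq_iff[of X "rep C"] P_Obj C by simp
    thus "rep C \<in> P \<phi>" by (rule P_iso_obj[OF X(1)])
  next
    assume "rep C \<in> P \<phi>"
    thus "\<exists>X \<in> P \<phi>. C = iso_class D X" using C(2) by auto
  qed
  hence "SS D (Zc, P) \<phi> C = of_bool (rep C \<in> P \<phi>)" unfolding SS_def by simp
  thus ?thesis using hall_unit_eq[OF assms] P_zero_object[of "rep C" \<phi>] by auto
qed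

text \<open>The induction step: multiplying by the nonzero semistable objects of a smaller phase appends this
  phase to the type.\<close>

lemma hall_mult_HN_type:
  assumes F: "\<And>C. C \<in> iso_classes D \<Longrightarrow> F C = of_bool (HN_type D P \<phi>s (rep C))"
    and G: "\<And>C. C \<in> iso_classes D \<Longrightarrow> G C = of_bool (rep C \<in> P \<phi> \<and> \<not> zero_object D (rep C))"
    and less: "\<forall>\<psi> \<in> set \<phi>s. \<phi> < \<psi>"
  shows "hall_mult_defined D F G"
    and "\<And>L. L \<in> iso_classes D \<Longrightarrow> hall_mult D F G L = of_bool (HN_type D P (\<phi>s @ [\<phi>]) (rep L))"
proof -
  \<comment> \<open>The index set of the nonzero terms at \<open>L\<close>; it is empty or a singleton, with term 1.\<close>
  define S where
    "S L = {MN \<in> iso_classes D \<times> iso_classes D. hall_term D F G L MN \<noteq> 0}" for L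
  have S_iff: "(M, N) \<in> S L \<longleftrightarrow> M \<in> iso_classes D \<and> N \<in> iso_classes D \<and>
      HN_type D P \<phi>s (rep M) \<and> rep N \<in> P \<phi> \<and> \<not> zero_object D (rep N) \<and>
      (\<exists>f g h. dtri D (rep M) (rep L) (rep N) f g h)"
    and term_eq_1: "(M, N) \<in> S L \<Longrightarrow> hall_term D F G L (M, N) = 1"
    if L: "L \<in> iso_classes D" for L M N
  proof -
    have one: "hall_number D (rep M) (rep N) (rep L) = 1"
      if HN: "HN_type D P \<phi>s (rep M)" "rep N \<in> P \<phi>" and T: "dtri D (rep M) (rep L) (rep N) f g h" for f g h
      using hall_number_orthogonal[OF T HN_type_orthogonal[OF HN(1) less HN(2)]]
        finite_shifted_mor P_Obj[OF HN(2)] by blast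
    have nz: "\<exists>f g h. dtri D (rep M) (rep L) (rep N) f g h"
      if "hall_number D (rep M) (rep N) (rep L) \<noteq> 0" "M \<in> iso_classes D" "N \<in> iso_classes D"
      using hall_number_nonzeroD[OF that(1)] rep_iso_class(1) that(2,3) L by blast
    show iff: "(M, N) \<in> S L \<longleftrightarrow> M \<in> iso_classes D \<and> N \<in> iso_classes D \<and>
      HN_type D P \<phi>s (rep M) \<and> rep N \<in> P \<phi> \<and> \<not> zero_object D (rep N) \<and>
      (\<exists>f g h. dtri D (rep M) (rep L) (rep N) f g h)"
      unfolding S_def hall_term_def using F[of M] G[of N] one nz by auto
    show "hall_term D F G L (M, N) = 1" if "(M, N) \<in> S L"
      using that one F[of M] G[of N] unfolding iff hall_term_def by auto
  qed
  have S_unique: "p = q" if L: "L \<in> iso_classes D" and pq: "p \<in> S L" "q \<in> S L" for L p q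
  proof -
    obtain M N M' N' where p: "p = (M, N)" and q: "q = (M', N')" by (cases p, cases q) blast
    obtain f g h where M: "M \<in> iso_classes D" "N \<in> iso_classes D" "HN_type D P \<phi>s (rep M)"
      "rep N \<in> P \<phi>" "dtri D (rep M) (rep L) (rep N) f g h"
      using pq(1) unfolding p S_iff[OF L] by blast
    obtain f' g' h' where M': "M' \<in> iso_classes D" "N' \<in> iso_classes D" "HN_type D P \<phi>s (rep M')"
      "rep N' \<in> P \<phi>" "dtri D (rep M') (rep L) (rep N') f' g' h'"
      using pq(2) unfolding q S_iff[OF L] by blast
    note o = HN_type_orthogonal[OF M(3) less M(4)] HN_type_orthogonal[OF M(3) less M'(4)]
      HN_type_orthogonal[OF M'(3) less M(4)] HN_type_orthogonal[OF M'(3) less M'(4)]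
    have "iso_obj D (rep M) (rep M')" by (rule subobject_unique[OF M(5) M'(5) o])
    hence "iso_class D (rep M) = iso_class D (rep M')"
      using iso_class_eq_iff[OF rep_iso_class(1)[OF M(1)]] by simp
    moreover have "iso_obj D (rep N) (rep N')"
      unfolding iso_obj_def using quotient_unique[OF M(5) M'(5) o] rep_iso_class(1) M(2) M'(2) by blast
    hence "iso_class D (rep N) = iso_class D (rep N')"
      using iso_class_eq_iff[OF rep_iso_class(1)[OF M(2)]] by simp
    ultimately show ?thesis
      unfolding p q using rep_iso_class(2) M(1,2) M'(1,2) by simp
  qed
  have S_finite: "finite (S L)" if "L \<in> iso_classes D" for L
  proof (cases "S L = {}")
    case False
    then obtain p where "p \<in> S L" by blast
    hence "S L \<subseteq> {p}" using S_unique[OF that] by blast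
    thus ?thesis by (rule finite_subset) simp
  qed simp
  thus "hall_mult_defined D F G" unfolding hall_mult_defined_def S_def by blast
  fix L assume L: "L \<in> iso_classes D"
  have L': "rep L \<in> Obj D" by (rule rep_iso_class(1)[OF L])
  show "hall_mult D F G L = of_bool (HN_type D P (\<phi>s @ [\<phi>]) (rep L))"
  proof (cases "HN_type D P (\<phi>s @ [\<phi>]) (rep L)")
    case True
    then obtain M A u v w where M: "HN_type D P \<phi>s M" "dtri D M (rep L) A u v w" "A \<in> P \<phi>"
        "\<not> zero_object D A"
      unfolding HN_type_snoc_iff by blast
    define CM where "CM = iso_class D M"
    define CA where "CA = iso_class D A"
    have o: "M \<in> Obj D" "A \<in> Obj D" using tri_typed[OF M(2)] by simp_all
    have C: "CM \<in> iso_classes D" "CA \<in> iso_classes D"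
      unfolding CM_def CA_def iso_classes_def using o by simp_all
    have i: "iso_obj D M (rep CM)" "iso_obj D A (rep CA)"
      using iso_class_eq_iff[OF o(1), of "rep CM"] iso_class_eq_iff[OF o(2), of "rep CA"]
        rep_iso_class(2) C unfolding CM_def CA_def by simp_all
    have "(CM, CA) \<in> S L"
      unfolding S_iff[OF L]
      using C HN_type_iso_obj[OF M(1) i(1)] P_iso_obj[OF M(3) i(2)] M(4)
        zero_object_iso_obj[OF _ iso_obj_sym[OF i(2)]]
        triangle_iso_obj[OF M(2) i(1) iso_obj_refl[OF L'] i(2)] by blast
    moreover from this have "S L = {(CM, CA)}" using S_unique[OF L] by blast
    ultimately show ?thesis
      using True term_eq_1[OF L] unfolding hall_mult_def sum.G_def S_def[symmetric] by simp
  next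
    case False
    have "(M, N) \<notin> S L" for M N
      using False HN_type_snoc_iff[of D P \<phi>s \<phi> "rep L"] S_iff[OF L, of M N] by blast
    hence "S L = {}" by auto
    thus ?thesis using False unfolding hall_mult_def sum.G_def S_def[symmetric] by simp
  qed
qed

abbreviation semistable_part :: "real \<Rightarrow> 'o set \<Rightarrow> rat"
  where "semistable_part \<equiv> \<lambda>\<phi> C. SS D (Zc, P) \<phi> C - hall_unit D C"

lemma hall_prod_eq_HN_type:
  assumes "\<phi>s \<noteq> []" "sorted_wrt (>) \<phi>s" "L \<in> iso_classes D"
  shows "hall_prod D (map semistable_part \<phi>s) L = of_bool (HN_type D P \<phi>s (rep L))"
  using assms
proof (induction \<phi>s arbitrary: L rule: rev_nonempty_induct)
  case (single \<phi>)
  thus ?case using SS_minus_unit_eq by (simp add: hall_prod_def HN_type_singleton_iff)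
next
  case (snoc \<phi> \<phi>s)
  have s: "\<forall>\<psi> \<in> set \<phi>s. \<phi> < \<psi>" "sorted_wrt (>) \<phi>s" using snoc.prems(1) by (auto simp: sorted_wrt_append)
  have "hall_prod D (map semistable_part (\<phi>s @ [\<phi>]))
      = hall_mult D (hall_prod D (map semistable_part \<phi>s)) (semistable_part \<phi>)"
    using snoc.hyps by (simp add: hall_prod_snoc)
  thus ?case
    using hall_mult_HN_type(2)[OF snoc.IH[OF s(2)] SS_minus_unit_eq s(1) snoc.prems(2)] by simp
qed

lemma hall_prod_defined_descending:
  assumes "sorted_wrt (>) \<phi>s"
  shows "hall_prod_defined D (map semistable_part \<phi>s)"
  unfolding hall_prod_defined_def
proof (intro allI impI)
  fix i assume i: "0 < i" "i < length (map semistable_part \<phi>s)"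
  hence ne: "take i \<phi>s \<noteq> []" by auto
  have "sorted_wrt (>) (take i \<phi>s @ [\<phi>s ! i])"
    using assms i sorted_wrt_take[of _ \<phi>s "Suc i"] by (simp add: take_Suc_conv_app_nth)
  hence s: "sorted_wrt (>) (take i \<phi>s)" "\<forall>\<psi> \<in> set (take i \<phi>s). \<phi>s ! i < \<psi>"
    by (auto simp: sorted_wrt_append)
  have "hall_mult_defined D (hall_prod D (map semistable_part (take i \<phi>s))) (semistable_part (\<phi>s ! i))"
    by (rule hall_mult_HN_type(1)[OF hall_prod_eq_HN_type[OF ne s(1)] SS_minus_unit_eq s(2)])
  thus "hall_mult_defined D (hall_prod D (take i (map semistable_part \<phi>s))) (map semistable_part \<phi>s ! i)"
    using i by (simp add: take_map)
qed

lemma descending_term_eq: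
  assumes "\<phi>s \<in> descending_phases" "L \<in> iso_classes D"
  shows "descending_term D (SS D (Zc, P)) L \<phi>s = of_bool (HN_type D P \<phi>s (rep L))"
proof -
  have "\<phi>s \<noteq> []" "sorted_wrt (>) \<phi>s" using assms(1) unfolding descending_phases_def by simp_all
  from hall_prod_eq_HN_type[OF this assms(2)] show ?thesis unfolding descending_term_def .
qed

text \<open>The empty list is not an index of the product; it is the type of the zero objects, whose value 1
  comes from the unit in front of the sum.\<close>

lemma descending_terms_nonzero:
  assumes "L \<in> iso_classes D" "HN_type D P \<phi>s (rep L)" "sorted_wrt (>) \<phi>s"
  shows "{\<psi>s \<in> descending_phases. descending_term D (SS D (Zc, P)) L \<psi>s \<noteq> 0} = {\<phi>s} - {[]}"
proof -
  have "{\<psi>s \<in> descending_phases. descending_term D (SS D (Zc, P)) L \<psi>s \<noteq> 0}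
      = {\<psi>s \<in> descending_phases. HN_type D P \<psi>s (rep L)}"
    using descending_term_eq[OF _ assms(1)] by auto
  also have "\<dots> = {\<phi>s} - {[]}"
    using HN_type_unique[OF _ assms(2) _ assms(3)] assms(2,3) unfolding descending_phases_def by blast
  finally show ?thesis .
qed

lemma descending_product_SS:
  assumes L: "L \<in> iso_classes D"
  shows "descending_product D (SS D (Zc, P)) L = 1"
proof -
  obtain \<phi>s where HN: "sorted_wrt (>) \<phi>s" "HN_type D P \<phi>s (rep L)"
    using HN_type_exists[OF rep_iso_class(1)[OF L]] by blast
  note sum_eq = sum.G_def[of "descending_term D (SS D (Zc, P)) L" descending_phases,
      unfolded descending_terms_nonzero[OF L HN(2,1)]]
  show ?thesis
  proof (cases "\<phi>s = []")
    case True
    hence "zero_object D (rep L)" using HN(2) by (simp add: HN_type_Nil_iff)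
    thus ?thesis unfolding descending_product_def sum_eq hall_unit_eq[OF L] using True by simp
  next
    case False
    hence d: "\<phi>s \<in> descending_phases" using HN(1) unfolding descending_phases_def by simp
    have "\<not> zero_object D (rep L)"
      using HN_type_unique[OF HN_type.zero HN(2) _ HN(1)] False by auto
    thus ?thesis
      unfolding descending_product_def sum_eq hall_unit_eq[OF L]
      using False HN(2) descending_term_eq[OF d L] by simp
  qed
qed

lemma descending_product_defined_SS: "descending_product_defined D (SS D (Zc, P))"
  unfolding descending_product_defined_def
proof (intro conjI ballI)
  fix \<phi>s :: "real list" assume "\<phi>s \<in> descending_phases"
  thus "hall_prod_defined D (map semistable_part \<phi>s)"
    using hall_prod_defined_descending unfolding descending_phases_def by simp
next
  fix L assume L: "L \<in> iso_classes D"
  obtain \<phi>s where HN: "sorted_wrt (>) \<phi>s" "HN_type D P \<phi>s (rep L)"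
    using HN_type_exists[OF rep_iso_class(1)[OF L]] by blast
  show "finite {\<phi>s \<in> descending_phases. descending_term D (SS D (Zc, P)) L \<phi>s \<noteq> 0}"
    unfolding descending_terms_nonzero[OF L HN(2,1)] by simp
qed

end

section \<open>The wall-crossing formula\<close>

theorem theorem4p19:
  fixes K :: "('k, 'r) ring_scheme"
    and D :: "('k, 'o, 'm, 'z) tricat_scheme"
    and \<sigma> :: "(('o \<Rightarrow>\<^sub>0 int) set \<Rightarrow> complex) \<times> (real \<Rightarrow> 'o set)"
  assumes "finite (carrier K)"
    and "triangulated_category K D"
    and "krull_schmidt D"
    and "left_homologically_finite K D"
    and "stability_condition D \<sigma>"
  shows "descending_product_defined D (SS D \<sigma>) \<and>
    (\<forall>L \<in> iso_classes D. one_cat D L = descending_product D (SS D \<sigma>) L)"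
proof -
  obtain Z P where \<sigma>: "\<sigma> = (Z, P)" by (cases \<sigma>)
  interpret triangulated_category K D by (rule assms(2))
  interpret finite_stable_category K D Z P
    by unfold_locales (use assms \<sigma> in simp_all)
  show ?thesis
    unfolding \<sigma> one_cat_def using descending_product_defined_SS descending_product_SS by simp
qed

end
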